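(* In any fine mixed subdivision of $n\Delta_{d-1}$, (a) there are exactly $n$ tiles which are simplices, and (b) the locations of the $n$ simplices give a basis of the matroid $\mathcal{T}_{n,d}$.
   Context: Here $n$ and $d$ are positive integers, $\Delta_{d-1}=\mathrm{conv}(e_1,\dots,e_d)\subset\mathbb{R}^d$, and $n\Delta_{d-1}$ is the Minkowski sum of $n$ copies of $\Delta_{d-1}$. A fine mixed cell of $n\Delta_{d-1}$ is a Minkowski sum $B_1+\cdots+B_n$, where the $B_i$ are (nonempty) faces of $\Delta_{d-1}$ which lie in independent affine subspaces (the sum of their linear direction spaces is direct) and whose dimensions add up to $d-1$. A fine mixed subdivision of $n\Delta_{d-1}$ is a tiling of $n\Delta_{d-1}$ by finitely many fine mixed cells (the tiles) such that the intersection of any two tiles is a (possibly empty) face of both. A tile that is a simplex is a translate $x+\Delta_{d-1}$ with $x\in T_{n,d}=\{x\in\mathbb{Z}_{\ge0}^d:x_1+\cdots+x_d=n-1\}$; the point $x$ is its location. $\mathcal{T}_{n,d}$ is the matroid on the ground set $T_{n,d}$ whose independent sets are the subsets $I$ of $T_{n,d}$ such that, for every $1\le k\le n$ and all $a\in\mathbb{Z}_{\ge0}^d$ with $a_1+\cdots+a_d=n-k$, the set $\{x\in T_{n,d}:x_i\ge a_i\text{ for all }i\}$ (a parallel translate of $T_{k,d}$) contains at most $k$ points of $I$.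
   Formalization: Part (a) is stated only when d ≥ 2 or n = 1: for d = 1 and n ≥ 2, nΔ_0 is a single point whose only subdivision has one tile, so "exactly n simplices" is false; part (b) is stated for all n, d ≥ 1. *)

theory Defs
  imports "HOL-Analysis.Analysis" "HOL-Library.Set_Algebras"
begin

text \<open>
  The index type \<open>'d\<close> has \<open>d\<close> elements, so \<open>\<real>\<^sup>d\<close> is \<open>real ^ 'd\<close>.
  Sums of sets are Minkowski sums, as in \<open>HOL-Library.Set_Algebras\<close>.
\<close>

definition std_simplex :: "(real ^ 'd) set" where
  "std_simplex = convex hull (range (\<lambda>i. axis i 1))"

definition dilated_simplex :: "nat \<Rightarrow> (real ^ 'd) set" where
  "dilated_simplex n = (\<Sum>i<n. std_simplex)"

definition direction_space :: "(real ^ 'd) set \<Rightarrow> (real ^ 'd) set" where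
  "direction_space S = span {x - y | x y. x \<in> S \<and> y \<in> S}"

definition direct_directions :: "nat \<Rightarrow> (nat \<Rightarrow> (real ^ 'd) set) \<Rightarrow> bool" where
  "direct_directions n B \<longleftrightarrow>
     (\<forall>v. (\<forall>i<n. v i \<in> direction_space (B i)) \<and> (\<Sum>i<n. v i) = 0 \<longrightarrow> (\<forall>i<n. v i = 0))"

definition fine_mixed_cell :: "nat \<Rightarrow> (real ^ 'd) set \<Rightarrow> bool" where
  "fine_mixed_cell n C \<longleftrightarrow>
     (\<exists>B :: nat \<Rightarrow> (real ^ 'd) set.
        (\<forall>i<n. B i face_of std_simplex \<and> B i \<noteq> {}) \<and>
        direct_directions n B \<and>
        (\<Sum>i<n. aff_dim (B i)) = int CARD('d) - 1 \<and>
        C = (\<Sum>i<n. B i))"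

text \<open>
  Tiles are sets of points: the same set may arise from several tuples of summands, and counts as
  one tile. Relative interiors are used because the tiles lie in a hyperplane.
\<close>

definition fine_mixed_subdivision :: "nat \<Rightarrow> (real ^ 'd) set set \<Rightarrow> bool" where
  "fine_mixed_subdivision n S \<longleftrightarrow>
     finite S \<and>
     (\<forall>C\<in>S. fine_mixed_cell n C) \<and>
     \<Union>S = dilated_simplex n \<and>
     pairwise (\<lambda>C D. disjnt (rel_interior C) (rel_interior D)) S \<and>
     (\<forall>C\<in>S. \<forall>D\<in>S. (C \<inter> D) face_of C \<and> (C \<inter> D) face_of D)"

definition simplex_tiles :: "(real ^ 'd) set set \<Rightarrow> (real ^ 'd) set set" where
  "simplex_tiles S = {C \<in> S. \<exists>k. k simplex C}"

text \<open>The conditions \<open>x\<^sub>1 + \<dots> + x\<^sub>d = n - 1\<close> and \<open>a\<^sub>1 + \<dots> + a\<^sub>d = n - k\<close> are written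
  additively to avoid truncated subtraction.\<close>

definition T_points :: "nat \<Rightarrow> (nat ^ 'd) set" where
  "T_points n = {x. (\<Sum>i\<in>UNIV. x $ i) + 1 = n}"

definition T_indep :: "nat \<Rightarrow> (nat ^ 'd) set \<Rightarrow> bool" where
  "T_indep n I \<longleftrightarrow>
     I \<subseteq> T_points n \<and>
     (\<forall>k\<in>{1..n}. \<forall>a :: nat ^ 'd. (\<Sum>i\<in>UNIV. a $ i) + k = n \<longrightarrow>
        card ({x \<in> T_points n. \<forall>i. a $ i \<le> x $ i} \<inter> I) \<le> k)"

text \<open>A basis of a matroid, given by its independent sets, is a maximal independent set.\<close>

definition matroid_basis :: "('a set \<Rightarrow> bool) \<Rightarrow> 'a set \<Rightarrow> bool" where
  "matroid_basis indep B \<longleftrightarrow> indep B \<and> (\<forall>I. indep I \<and> B \<subseteq> I \<longrightarrow> I = B)"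

definition simplex_locations :: "nat \<Rightarrow> (real ^ 'd) set set \<Rightarrow> (nat ^ 'd) set" where
  "simplex_locations n S =
     {x \<in> T_points n. (+) (\<chi> i. real (x $ i)) ` std_simplex \<in> simplex_tiles S}"

end

theory Submission
  imports Defs
begin

text \<open>
  For a set \<open>J\<close> of at least two coordinates, let \<open>X J\<close> be the set of all \<open>y\<close> for which
  \<open>y + \<Delta>\<^sub>J\<close> is a face of some tile. Given \<open>k \<notin> J\<close> and \<open>y \<in> X J\<close> with \<open>y\<^sub>k > 0\<close>, a tile containing a
  short segment from the barycenter of \<open>y + \<Delta>\<^sub>J\<close> in the direction \<open>-e\<^sub>k\<close> (modulo \<open>\<Delta>\<^sub>J\<close>) also
  has a face \<open>y' + \<Delta>\<^sub>J\<close> with \<open>y' = y - e\<^sub>k + e\<^sub>i\<close>, \<open>i \<in> J\<close>. Because the directions of the summands of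
  a tile are independent and tiles meet in common faces, \<open>y \<mapsto> y'\<close> is injective and never hits a \<open>y'\<close>
  with \<open>y' + \<Delta>\<^bsub>J \<union> {k}\<^esub>\<close> a face. Descending to the level \<open>y\<^sub>k = a\<^sub>k\<close> shows that the number of
  \<open>y \<in> X J\<close> with \<open>y \<ge> a\<close> on \<open>J\<close> and \<open>y = a\<close> off \<open>J\<close> does not increase when \<open>J\<close> is enlarged. For
  \<open>card J = 2\<close> it is at most \<open>n - \<Sum>a\<close>, being a number of lattice points on a line, which gives
  independence. For \<open>a = 0\<close> the construction can be reversed, so the number is always \<open>n\<close>.
\<close>

subsection \<open>Faces of the standard simplex and of mixed cells\<close>

definition face_simplex :: "'d set \<Rightarrow> (real ^ 'd) set" where
  "face_simplex J = convex hull ((\<lambda>i. axis i 1) ` J)"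

definition real_vec :: "nat ^ 'd \<Rightarrow> real ^ 'd" where
  "real_vec y = (\<chi> i. real (y $ i))"

definition placed_simplex :: "nat ^ 'd \<Rightarrow> 'd set \<Rightarrow> (real ^ 'd) set" where
  "placed_simplex y J = (+) (real_vec y) ` face_simplex J"

text \<open>For nonempty \<open>J\<close> all coordinates on \<open>J\<close> are positive. This
  point therefore detects the whole simplex: a face of a tile containing it contains every
  vertex.\<close>

definition bary :: "'d set \<Rightarrow> real ^ 'd" where
  "bary J = (\<chi> i. if i \<in> J then 1 / real (card J) else 0)"

text \<open>Neither directness nor a dimension is imposed, so that shrinking the index sets
  \<open>A j\<close> stays within this form; the relevant faces of a tile arise in this way.\<close>

definition mixed_cell :: "nat \<Rightarrow> (nat \<Rightarrow> 'd set) \<Rightarrow> (real ^ 'd) set" where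
  "mixed_cell n A = (\<Sum>j<n. face_simplex (A j))"

definition direct_cell :: "nat \<Rightarrow> (nat \<Rightarrow> 'd :: finite set) \<Rightarrow> bool" where
  "direct_cell n A \<longleftrightarrow> direct_directions n (\<lambda>j. face_simplex (A j))"

text \<open>A translate \<open>y + \<Delta>\<^sub>J\<close> is a face of the cell \<open>\<Sum>j<n. \<Delta>\<^bsub>A j\<^esub>\<close> if it arises by choosing the face \<open>J\<close> in
  the summand \<open>j0\<close> and a single vertex \<open>f j\<close> in each of the others.\<close>

definition cell_face :: "nat \<Rightarrow> (nat \<Rightarrow> 'd :: finite set) \<Rightarrow> 'd set \<Rightarrow> nat ^ 'd \<Rightarrow> nat \<Rightarrow> (nat \<Rightarrow> 'd) \<Rightarrow> bool" where
  "cell_face n A J y j0 f \<longleftrightarrow>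
     j0 < n \<and> J \<subseteq> A j0 \<and> (\<forall>j\<in>{..<n} - {j0}. f j \<in> A j) \<and>
     y = (\<Sum>j\<in>{..<n} - {j0}. axis (f j) 1)"

section \<open>Vectors with natural and real coordinates, and the faces of the simplex\<close>

lemma axis_nth_if: "axis i (c :: 'a :: zero) $ l = (if l = i then c else 0)"
  by (simp add: axis_def)

lemma sum_axis_one [simp]: "(\<Sum>l\<in>UNIV. axis i (1 :: 'a :: comm_semiring_1) $ l) = 1"
  by (simp add: axis_nth_if)

lemma axis_eq_iff [simp]: "axis i (1 :: real) = axis j 1 \<longleftrightarrow> i = j"
  by (metis axis_eq_axis zero_neq_one)

lemma real_vec_nth [simp]: "real_vec y $ i = real (y $ i)"
  by (simp add: real_vec_def)

lemma real_vec_add: "real_vec (x + y) = real_vec x + real_vec y"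
  by (simp add: vec_eq_iff)

lemma real_vec_axis [simp]: "real_vec (axis i (Suc 0)) = axis i 1"
  by (simp add: vec_eq_iff axis_nth_if)

lemma real_vec_0 [simp]: "real_vec 0 = 0"
  by (simp add: vec_eq_iff)

lemma real_vec_sum: "real_vec (sum f I) = (\<Sum>i\<in>I. real_vec (f i))"
  by (simp add: vec_eq_iff)

lemma real_vec_inject [simp]: "real_vec x = real_vec y \<longleftrightarrow> x = y"
  by (simp add: vec_eq_iff)

text \<open>The right-hand side is convex and contains the vertices; conversely, the coordinates of
  a point serve as its convex weights.\<close>

lemma face_simplex_altdef:
  "face_simplex J = {x :: real ^ 'd. (\<forall>i. 0 \<le> x $ i) \<and> (\<Sum>i\<in>UNIV. x $ i) = 1 \<and> (\<forall>i. i \<notin> J \<longrightarrow> x $ i = 0)}"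
    (is "_ = ?R")
proof
  show "face_simplex J \<subseteq> ?R"
    unfolding face_simplex_def
  proof (rule hull_minimal)
    show "convex ?R"
      by (auto simp: convex_def sum.distrib simp flip: sum_distrib_left)
  qed (auto simp: axis_nth_if)
next
  show "?R \<subseteq> face_simplex J"
  proof
    fix x :: "real ^ 'd" assume x: "x \<in> ?R"
    have s: "(\<Sum>i\<in>J. x $ i) = 1"
      using x sum.mono_neutral_left[of UNIV J "\<lambda>i. x $ i"] by auto
    have "(\<Sum>i\<in>J. x $ i *\<^sub>R axis i 1) = x"
    proof -
      have "(\<Sum>i\<in>J. x $ i *\<^sub>R axis i (1::real)) $ l = x $ l" for l
        using x by (auto simp: axis_nth_if if_distrib[of "(*) _"] cong: if_cong)
      then show ?thesis by (simp add: vec_eq_iff)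
    qed
    moreover have "(\<Sum>i\<in>J. x $ i *\<^sub>R axis i (1::real)) \<in> face_simplex J"
      unfolding face_simplex_def
      by (rule convex_sum) (use x s in \<open>auto intro: hull_inc\<close>)
    ultimately show "x \<in> face_simplex J" by simp
  qed
qed

lemma convex_face_simplex: "convex (face_simplex J)"
  by (simp add: face_simplex_def)

lemma axis_in_face_simplex: "i \<in> J \<Longrightarrow> axis i 1 \<in> face_simplex J"
  by (auto simp: face_simplex_def intro: hull_inc)

lemma face_simplex_mono: "J \<subseteq> K \<Longrightarrow> face_simplex J \<subseteq> face_simplex K"
  by (auto simp: face_simplex_altdef)

lemma face_simplex_singleton [simp]: "face_simplex {i} = {axis i 1}"
  by (simp add: face_simplex_def)

lemma face_simplex_UNIV: "face_simplex UNIV = std_simplex"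
  by (simp add: face_simplex_def std_simplex_def)

lemma face_simplex_empty_iff [simp]: "face_simplex J = {} \<longleftrightarrow> J = {}"
  by (simp add: face_simplex_def)

lemma ex_pos_face_simplex:
  assumes "x \<in> face_simplex J"
  obtains s where "s \<in> J" "0 < x $ s"
proof -
  have "\<exists>s. 0 < x $ s"
  proof (rule ccontr)
    assume "\<not> ?thesis"
    with assms have "\<And>s. x $ s = 0"
      by (auto simp: face_simplex_altdef not_less intro: antisym)
    with assms show False by (auto simp: face_simplex_altdef)
  qed
  then show ?thesis using assms that by (force simp: face_simplex_altdef)
qed

text \<open>Splits off a vertex of positive weight, ready for \<open>face_ofD_convex_comb\<close>.
  The vertex itself is a separate case because the remainder is rescaled by
  \<open>1 / (1 - x $ i)\<close>.\<close>

lemma face_simplex_split: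
  assumes "x \<in> face_simplex J" "0 < x $ i"
  obtains "x = axis i 1" 
  | z where "x $ i < 1" "z \<in> face_simplex J" "x = (x $ i) *\<^sub>R axis i 1 + (1 - x $ i) *\<^sub>R z"
proof -
  have x: "\<And>l. 0 \<le> x $ l" "(\<Sum>l\<in>UNIV. x $ l) = 1" "\<And>l. l \<notin> J \<Longrightarrow> x $ l = 0"
    using assms by (auto simp: face_simplex_altdef)
  have split: "(\<Sum>l\<in>UNIV. x $ l) = x $ i + (\<Sum>l\<in>UNIV - {i}. x $ l)"
    by (simp add: sum.remove)
  have le: "x $ i \<le> 1"
    using split x by (smt (verit) sum_nonneg)
  show ?thesis
  proof (cases "x $ i = 1")
    case True
    then have "\<forall>l\<in>UNIV - {i}. x $ l = 0"
      using split x by (subst sum_nonneg_eq_0_iff[symmetric]) auto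
    then have "x = axis i 1"
      using True by (auto simp: vec_eq_iff axis_nth_if)
    then show ?thesis by (rule that(1))
  next
    case False
    define z where "z = (1 / (1 - x $ i)) *\<^sub>R (x - (x $ i) *\<^sub>R axis i 1)"
    have lt: "x $ i < 1" using False le by simp
    have "(\<Sum>l\<in>UNIV. z $ l) = (1 / (1 - x $ i)) * ((\<Sum>l\<in>UNIV. x $ l) - x $ i * (\<Sum>l\<in>UNIV. axis i 1 $ l))"
      by (simp add: z_def sum_subtractf flip: sum_distrib_left sum_divide_distrib)
    then have "(\<Sum>l\<in>UNIV. z $ l) = 1"
      using lt x by simp
    moreover have "0 \<le> z $ l" for l
      using lt x by (simp add: z_def axis_nth_if)
    moreover have "z $ l = 0" if "l \<notin> J" for l
      using that x assms(2) by (auto simp: z_def axis_nth_if)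
    ultimately have "z \<in> face_simplex J"
      by (auto simp: face_simplex_altdef)
    moreover have "x = (x $ i) *\<^sub>R axis i 1 + (1 - x $ i) *\<^sub>R z"
      using lt by (simp add: z_def)
    ultimately show ?thesis using lt that(2) by blast
  qed
qed

text \<open>The defining property of faces, extended to \<open>a = b\<close>, where the open segment
  is empty.\<close>

lemma face_ofD_convex_comb:
  assumes "F face_of C" "a \<in> C" "b \<in> C" "u *\<^sub>R a + (1 - u) *\<^sub>R b \<in> F" "0 < u" "u < (1 :: real)"
  shows "a \<in> F" "b \<in> F"
proof -
  have "a \<in> F \<and> b \<in> F"
  proof (cases "a = b")
    case True
    then show ?thesis using assms by (simp add: algebra_simps)
  next
    case False
    then have "u *\<^sub>R a + (1 - u) *\<^sub>R b \<in> open_segment b a"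
      using assms by (auto simp: in_segment algebra_simps intro!: exI[of _ u])
    then show ?thesis using assms unfolding face_of_def by blast
  qed
  then show "a \<in> F" "b \<in> F" by auto
qed

text \<open>A positive combination of two nonnegative coordinates vanishes only if both do.\<close>

lemma face_simplex_face_of:
  fixes J K :: "'d :: finite set"
  assumes "J \<subseteq> K"
  shows "face_simplex J face_of face_simplex K"
  unfolding face_of_def
proof (intro conjI ballI impI)
  show "face_simplex J \<subseteq> face_simplex K" by (rule face_simplex_mono[OF assms])
next
  fix a b x :: "real ^ 'd"
  assume a: "a \<in> face_simplex K" and b: "b \<in> face_simplex K" and x: "x \<in> face_simplex J" 
    and seg: "x \<in> open_segment a b"
  from seg obtain u where u: "0 < u" "u < 1" "x = (1 - u) *\<^sub>R a + u *\<^sub>R b"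
    by (auto simp: in_segment)
  have "a $ i = 0 \<and> b $ i = 0" if "i \<notin> J" for i
  proof -
    have "(1 - u) * a $ i + u * b $ i = 0" using x that u by (auto simp: face_simplex_altdef)
    moreover have "0 \<le> a $ i" "0 \<le> b $ i" using a b by (auto simp: face_simplex_altdef)
    ultimately show ?thesis using u
      by (smt (verit) mult_nonneg_nonneg mult_pos_pos)
  qed
  then show "a \<in> face_simplex J" "b \<in> face_simplex J" using a b by (auto simp: face_simplex_altdef)
qed (rule convex_face_simplex)

lemma face_of_std_simplex:
  assumes "B face_of std_simplex" "B \<noteq> {}"
  obtains A where "A \<noteq> {}" "B = face_simplex A"
proof -
  obtain S' where "S' \<subseteq> range (\<lambda>i. axis i 1)" "B = convex hull S'"
    using face_of_convex_hull_subset[of "range (\<lambda>i. axis i 1)" B] assms(1)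
    unfolding std_simplex_def by (metis finite finite_imageI finite_imp_compact)
  then obtain A where "B = face_simplex A"
    unfolding face_simplex_def by (metis subset_image_iff)
  with assms(2) that show ?thesis by auto
qed

lemma bary_nth: "bary J $ i = (if i \<in> J then 1 / real (card J) else 0)"
  by (simp add: bary_def)

lemma bary_in: "J \<noteq> {} \<Longrightarrow> bary J \<in> face_simplex J"
  by (auto simp: face_simplex_altdef bary_nth sum.If_cases)

text \<open>The shift uses up the full weight at \<open>b\<close>: for \<open>a \<noteq> b\<close>
  that coordinate drops to 0.\<close>

lemma bary_perturb:
  assumes "a \<in> J" "b \<in> J"
  shows "bary J + (1 / real (card J)) *\<^sub>R (axis a 1 - axis b 1) \<in> face_simplex J"
proof -
  have "0 < card J" using assms card_gt_0_iff by fastforce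
  moreover have "(\<Sum>l\<in>UNIV. bary J $ l) = 1"
    using bary_in[of J] assms by (auto simp: face_simplex_altdef)
  ultimately show ?thesis using assms
    by (auto simp: face_simplex_altdef sum.distrib sum_subtractf bary_nth axis_nth_if
        simp flip: sum_divide_distrib)
qed

lemma placed_simplex_iff: "x \<in> placed_simplex y J \<longleftrightarrow> x - real_vec y \<in> face_simplex J"
  by (auto simp: placed_simplex_def image_iff algebra_simps intro!: bexI[of _ "x - real_vec y"])

text \<open>Every vertex has positive weight in the barycenter, so the face property pulls each
  vertex into \<open>G\<close>; convexity of \<open>G\<close> gives the rest.\<close>

lemma placed_simplex_subset_face:
  assumes G: "G face_of C" and sub: "placed_simplex y J \<subseteq> C" and b: "real_vec y + bary J \<in> G"
    and "J \<noteq> {}"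
  shows "placed_simplex y J \<subseteq> G"
proof -
  have *: "real_vec y + axis i 1 \<in> G" if "i \<in> J" for i
  proof -
    have pos: "0 < bary J $ i" using that by (auto simp: bary_nth card_gt_0_iff)
    show ?thesis
      using bary_in[OF \<open>J \<noteq> {}\<close>] pos
    proof (cases rule: face_simplex_split)
      case 1
      with b show ?thesis by simp
    next
      case (2 z)
      have "(bary J $ i) *\<^sub>R (real_vec y + axis i 1) + (1 - bary J $ i) *\<^sub>R (real_vec y + z)
           = real_vec y + ((bary J $ i) *\<^sub>R axis i 1 + (1 - bary J $ i) *\<^sub>R z)"
        by (simp add: algebra_simps)
      also have "\<dots> = real_vec y + bary J" using 2 by simp
      finally have eq: "(bary J $ i) *\<^sub>R (real_vec y + axis i 1) + (1 - bary J $ i) *\<^sub>R (real_vec y + z) \<in> G"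
        using b by simp
      show ?thesis
        by (rule face_ofD_convex_comb(1)[OF G _ _ eq pos])
          (use sub 2 that in \<open>auto simp: placed_simplex_def intro: axis_in_face_simplex\<close>)
    qed
  qed
  have "(+) (real_vec y) ` face_simplex J = convex hull ((\<lambda>i. real_vec y + axis i 1) ` J)"
    unfolding face_simplex_def by (simp add: image_image flip: convex_hull_translation)
  also have "\<dots> \<subseteq> G"
    using G by (intro hull_minimal) (auto simp: * face_of_imp_convex)
  finally show ?thesis by (simp add: placed_simplex_def)
qed

section \<open>Minkowski sums of faces and unique decomposition\<close>

lemma mixed_cell_iff:
  "x \<in> mixed_cell n A \<longleftrightarrow> (\<exists>b. (\<forall>j<n. b j \<in> face_simplex (A j)) \<and> x = (\<Sum>j<n. b j))"
  by (auto simp: mixed_cell_def set_sum_alt)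

lemma convex_mixed_cell: "convex (mixed_cell n A)"
  unfolding mixed_cell_def by (intro convex_set_sum convex_face_simplex)

text \<open>A sum of convex hulls is the hull of the sum, here of a finite set, hence
  compact.\<close>

lemma closed_mixed_cell: "closed (mixed_cell n (A :: nat \<Rightarrow> 'd :: finite set))"
proof -
  have "mixed_cell n A = convex hull (\<Sum>j<n. (\<lambda>i. axis i 1) ` A j)"
    by (simp add: mixed_cell_def face_simplex_def convex_hull_set_sum)
  moreover have "finite (\<Sum>j<n. (\<lambda>i. axis i (1::real)) ` A j)"
    by (intro finite_set_sum) auto
  ultimately show ?thesis
    by (simp add: compact_imp_closed compact_convex_hull finite_imp_compact)
qed

lemma mixed_cell_coords:
  assumes "x \<in> mixed_cell n A"
  shows "0 \<le> x $ i" "(\<Sum>i\<in>UNIV. x $ i) = real n"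
proof -
  obtain b where b: "\<forall>j<n. b j \<in> face_simplex (A j)" "x = (\<Sum>j<n. b j)"
    using assms by (auto simp: mixed_cell_iff)
  show "0 \<le> x $ i" using b by (auto simp: face_simplex_altdef intro!: sum_nonneg)
  have "(\<Sum>i\<in>UNIV. x $ i) = (\<Sum>j<n. \<Sum>i\<in>UNIV. b j $ i)"
    by (simp add: b sum.swap[of _ UNIV])
  also have "\<dots> = (\<Sum>j<n. 1)" using b by (intro sum.cong) (auto simp: face_simplex_altdef)
  finally show "(\<Sum>i\<in>UNIV. x $ i) = real n" by simp
qed

text \<open>Scaling by \<open>1 / n\<close> lands in \<open>std_simplex\<close>, and
  \<open>x\<close> is the sum of \<open>n\<close> copies of the scaled point.\<close>

lemma in_dilated_simplex:
  assumes "\<And>i. 0 \<le> x $ i" "(\<Sum>i\<in>UNIV. x $ i) = real n" "n \<ge> 1"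
  shows "x \<in> dilated_simplex n"
proof -
  have "(1 / real n) *\<^sub>R x \<in> std_simplex"
    unfolding face_simplex_UNIV[symmetric] face_simplex_altdef
    using assms by (simp flip: sum_divide_distrib)
  moreover have "x = (\<Sum>j<n. (1 / real n) *\<^sub>R x)"
    using assms(3) by (simp only: sum_constant_scaleR) simp
  ultimately show ?thesis
    unfolding dilated_simplex_def set_sum_alt[OF finite_lessThan] by blast
qed

lemma fine_mixed_cellE:
  assumes "fine_mixed_cell n (C :: (real ^ 'd) set)"
  obtains A where "C = mixed_cell n A" "direct_cell n A" "\<And>j. j < n \<Longrightarrow> A j \<noteq> {}"
    "(\<Sum>j<n. aff_dim (face_simplex (A j))) = int CARD('d) - 1"
proof -
  obtain B :: "nat \<Rightarrow> (real ^ 'd) set" where B: "\<forall>i<n. B i face_of std_simplex \<and> B i \<noteq> {}"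
    "direct_directions n B" "(\<Sum>i<n. aff_dim (B i)) = int CARD('d) - 1" "C = (\<Sum>i<n. B i)"
    using assms unfolding fine_mixed_cell_def by auto
  have "\<forall>i. \<exists>A. i < n \<longrightarrow> A \<noteq> {} \<and> B i = face_simplex A"
    using B(1) face_of_std_simplex by metis
  then obtain A where A: "\<And>i. i < n \<Longrightarrow> A i \<noteq> {} \<and> B i = face_simplex (A i)" by metis
  show ?thesis
  proof (rule that)
    show "C = mixed_cell n A" using A B by (simp add: mixed_cell_def)
    show "direct_cell n A" using A B by (simp add: direct_cell_def direct_directions_def)
    show "(\<Sum>j<n. aff_dim (face_simplex (A j))) = int CARD('d) - 1" using A B by simp
  qed (use A in auto)
qed

lemma direct_cellD:
  assumes "direct_cell n A" "\<And>j. j < n \<Longrightarrow> v j \<in> span {x - y | x y. x \<in> face_simplex (A j) \<and> y \<in> face_simplex (A j)}"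
    "(\<Sum>j<n. v j) = 0" "j < n"
  shows "v j = 0"
  using assms unfolding direct_cell_def direct_directions_def direction_space_def by blast

text \<open>The differences \<open>b j - c j\<close> lie in the direction spaces and sum to
  zero.\<close>

lemma direct_cell_unique:
  assumes "direct_cell n A" "\<And>j. j < n \<Longrightarrow> b j \<in> face_simplex (A j)" "\<And>j. j < n \<Longrightarrow> c j \<in> face_simplex (A j)"
    "(\<Sum>j<n. b j) = (\<Sum>j<n. c j)" "j < n"
  shows "b j = c j"
proof -
  have "b j - c j = 0"
    by (rule direct_cellD[OF assms(1) _ _ \<open>j < n\<close>])
       (use assms in \<open>auto simp: sum_subtractf intro!: span_base\<close>)
  then show ?thesis by simp
qed

text \<open>A common edge would put \<open>axis a 1 - axis b 1\<close> into one direction space and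
  its negative into another, a nontrivial relation.\<close>

lemma direct_cell_disjoint_pairs:
  assumes "direct_cell n A" "i < n" "j < n" "i \<noteq> j" "a \<in> A i" "b \<in> A i" "a \<in> A j" "b \<in> A j"
  shows "a = b"
proof -
  define v :: "nat \<Rightarrow> real ^ 'a" where 
    "v l = (if l = i then axis a 1 - axis b 1 else if l = j then axis b 1 - axis a 1 else 0)" for l
  have "v i = 0"
  proof (rule direct_cellD[OF assms(1) _ _ \<open>i < n\<close>])
    show "v l \<in> span {x - y |x y. x \<in> face_simplex (A l) \<and> y \<in> face_simplex (A l)}" if "l < n" for l
      using assms that by (auto simp: v_def span_zero intro!: span_base axis_in_face_simplex)
    have "(\<Sum>l<n. v l) = (\<Sum>l\<in>{i, j}. v l)"
      using assms by (intro sum.mono_neutral_right) (auto simp: v_def)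
    also have "\<dots> = 0" using assms by (simp add: v_def)
    finally show "(\<Sum>l<n. v l) = 0" .
  qed
  then show ?thesis by (simp add: v_def)
qed

text \<open>Uniqueness of decompositions turns a convex combination in the cell into one in each
  summand, where \<open>face_simplex_face_of\<close> applies.\<close>

lemma mixed_cell_face_of:
  fixes A A' :: "nat \<Rightarrow> 'd :: finite set"
  assumes "direct_cell n A" "\<And>j. j < n \<Longrightarrow> A' j \<subseteq> A j"
  shows "mixed_cell n A' face_of mixed_cell n A"
  unfolding face_of_def
proof (intro conjI ballI impI)
  show "mixed_cell n A' \<subseteq> mixed_cell n A"
    using face_simplex_mono[OF assms(2)] unfolding mixed_cell_iff subset_iff by blast
  show "convex (mixed_cell n A')" by (rule convex_mixed_cell)
next
  fix a b x :: "real ^ 'd"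
  assume a: "a \<in> mixed_cell n A" and b: "b \<in> mixed_cell n A" and x: "x \<in> mixed_cell n A'" 
    and seg: "x \<in> open_segment a b"
  from seg obtain u where u: "0 < u" "u < 1" "x = (1 - u) *\<^sub>R a + u *\<^sub>R b"
    by (auto simp: in_segment)
  from a obtain \<alpha> where \<alpha>: "\<forall>j<n. \<alpha> j \<in> face_simplex (A j)" "a = (\<Sum>j<n. \<alpha> j)" by (auto simp: mixed_cell_iff)
  from b obtain \<beta> where \<beta>: "\<forall>j<n. \<beta> j \<in> face_simplex (A j)" "b = (\<Sum>j<n. \<beta> j)" by (auto simp: mixed_cell_iff)
  from x obtain \<xi> where \<xi>: "\<forall>j<n. \<xi> j \<in> face_simplex (A' j)" "x = (\<Sum>j<n. \<xi> j)" by (auto simp: mixed_cell_iff)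
  have eq: "(1 - u) *\<^sub>R \<alpha> j + u *\<^sub>R \<beta> j = \<xi> j" if "j < n" for j
  proof (rule direct_cell_unique[OF assms(1) _ _ _ that, where b = "\<lambda>j. (1 - u) *\<^sub>R \<alpha> j + u *\<^sub>R \<beta> j"])
    show "(\<Sum>j<n. (1 - u) *\<^sub>R \<alpha> j + u *\<^sub>R \<beta> j) = sum \<xi> {..<n}"
      using u \<alpha> \<beta> \<xi> by (simp add: sum.distrib scaleR_sum_right)
    show "(1 - u) *\<^sub>R \<alpha> j + u *\<^sub>R \<beta> j \<in> face_simplex (A j)" if "j < n" for j
      using that u \<alpha> \<beta> convex_face_simplex[of "A j"] by (intro convexD) auto
    show "\<xi> j \<in> face_simplex (A j)" if "j < n" for j
      using that \<xi> face_simplex_mono[OF assms(2)] by blast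
  qed
  have "\<beta> j \<in> face_simplex (A' j) \<and> \<alpha> j \<in> face_simplex (A' j)" if "j < n" for j
    using face_ofD_convex_comb[OF face_simplex_face_of[OF assms(2)[OF that]], of "\<beta> j" "\<alpha> j" u]
      eq[OF that] \<alpha> \<beta> \<xi> u that by (simp add: add.commute)
  then show "a \<in> mixed_cell n A'" "b \<in> mixed_cell n A'"
    using \<alpha> \<beta> unfolding mixed_cell_iff by blast+
qed

text \<open>The placed simplex is the subcell with \<open>J\<close> in position \<open>j0\<close>
  and a single vertex in every other position.\<close>

lemma cell_face_imp_face_of:
  fixes A :: "nat \<Rightarrow> 'd :: finite set"
  assumes "direct_cell n A" "cell_face n A J y j0 f"
  shows "placed_simplex y J face_of mixed_cell n A"
proof -
  let ?A' = "\<lambda>j. if j = j0 then J else {f j}"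
  have c: "j0 < n" "J \<subseteq> A j0" "\<forall>j\<in>{..<n} - {j0}. f j \<in> A j"
     "y = (\<Sum>j\<in>{..<n} - {j0}. axis (f j) 1)"
    using assms(2) by (auto simp: cell_face_def)
  have ry: "real_vec y = (\<Sum>j\<in>{..<n} - {j0}. axis (f j) 1)"
    by (simp add: c(4) real_vec_sum)
  have split: "(\<Sum>j<n. b j) = b j0 + (\<Sum>j\<in>{..<n} - {j0}. b j)" for b :: "nat \<Rightarrow> real ^ 'd"
    using c(1) by (simp add: sum.remove)
  have "placed_simplex y J = mixed_cell n ?A'"
  proof (rule set_eqI)
    fix x
    show "x \<in> placed_simplex y J \<longleftrightarrow> x \<in> mixed_cell n ?A'"
    proof
      assume "x \<in> placed_simplex y J"
      then have x: "x - real_vec y \<in> face_simplex J" by (simp add: placed_simplex_iff)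
      have "x = (\<Sum>j<n. if j = j0 then x - real_vec y else axis (f j) 1)"
        unfolding split by (simp add: ry)
      then show "x \<in> mixed_cell n ?A'"
        using x unfolding mixed_cell_iff
        by (intro exI[of _ "\<lambda>j. if j = j0 then x - real_vec y else axis (f j) 1"]) auto
    next
      assume "x \<in> mixed_cell n ?A'"
      then obtain b where b: "\<forall>j<n. b j \<in> face_simplex (?A' j)" "x = (\<Sum>j<n. b j)"
        by (auto simp: mixed_cell_iff)
      have "b j = axis (f j) 1" if "j \<in> {..<n} - {j0}" for j
        using b(1)[rule_format, of j] that by simp
      then have "x = b j0 + real_vec y"
        unfolding b(2) split ry by simp
      then show "x \<in> placed_simplex y J"
        using b c(1) by (auto simp: placed_simplex_iff)
    qed
  qed
  moreover have "mixed_cell n ?A' face_of mixed_cell n A"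
    using c by (intro mixed_cell_face_of[OF assms(1)]) auto
  ultimately show ?thesis by simp
qed

lemma sum_fun_upd:
  fixes b :: "nat \<Rightarrow> 'a :: ab_group_add"
  assumes "j < n"
  shows "(\<Sum>l<n. (b(j := c)) l) = (\<Sum>l<n. b l) - b j + c"
proof -
  have "(\<Sum>l<n. (b(j := c)) l) = c + (\<Sum>l\<in>{..<n}-{j}. (b(j := c)) l)"
    using assms by (simp add: sum.remove)
  also have "(\<Sum>l\<in>{..<n}-{j}. (b(j := c)) l) = (\<Sum>l\<in>{..<n}-{j}. b l)"
    by (intro sum.cong) auto
  also have "\<dots> = (\<Sum>l<n. b l) - b j"
    using assms by (simp add: sum.remove)
  finally show ?thesis by simp
qed

text \<open>The two points obtained by exchanging the summand \<open>j\<close> have the same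
  midpoint as the original ones, and that midpoint lies in \<open>F\<close>.\<close>

lemma face_swap:
  assumes F: "F face_of mixed_cell n A"
    and b: "\<And>j. j < n \<Longrightarrow> b j \<in> face_simplex (A j)" and c: "\<And>j. j < n \<Longrightarrow> c j \<in> face_simplex (A j)"
    and bF: "(\<Sum>j<n. b j) \<in> F" and cF: "(\<Sum>j<n. c j) \<in> F" and "j < n"
  shows "(\<Sum>l<n. b l) - b j + c j \<in> F"
proof -
  have "(\<Sum>l<n. b l) - b j + c j \<in> mixed_cell n A"
    unfolding sum_fun_upd[OF \<open>j < n\<close>, of b "c j", symmetric] mixed_cell_iff
    using b c by (intro exI[of _ "b(j := c j)"]) auto
  moreover have "(\<Sum>l<n. c l) - c j + b j \<in> mixed_cell n A"
    unfolding sum_fun_upd[OF \<open>j < n\<close>, of c "b j", symmetric] mixed_cell_iff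
    using b c by (intro exI[of _ "c(j := b j)"]) auto
  moreover have "(1/2) *\<^sub>R ((\<Sum>l<n. b l) - b j + c j) + (1 - 1/2) *\<^sub>R ((\<Sum>l<n. c l) - c j + b j) \<in> F"
  proof -
    have "(1/2) *\<^sub>R ((\<Sum>l<n. b l) - b j + c j) + (1 - 1/2) *\<^sub>R ((\<Sum>l<n. c l) - c j + b j) =
       (1/2) *\<^sub>R (\<Sum>l<n. b l) + (1/2) *\<^sub>R (\<Sum>l<n. c l)"
      by (simp add: algebra_simps)
    also have "\<dots> \<in> F"
      using F bF cF by (intro convexD) (auto simp: face_of_imp_convex)
    finally show ?thesis .
  qed
  ultimately show ?thesis
    using face_ofD_convex_comb(1)[OF F] by fastforce
qed

text \<open>Splitting a vertex off \<open>b j\<close> writes \<open>p\<close> as a proper convex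
  combination of points of the cell, and extremality makes these equal to \<open>p\<close>.\<close>

lemma extreme_point_mixed_cell:
  assumes ext: "{p} face_of mixed_cell n A" and b: "\<And>j. j < n \<Longrightarrow> b j \<in> face_simplex (A j)" 
    and p: "p = (\<Sum>j<n. b j)" and "j < n"
  shows "\<exists>s\<in>A j. b j = axis s 1"
proof -
  obtain s where s: "s \<in> A j" "0 < b j $ s" using b[OF \<open>j < n\<close>] by (rule ex_pos_face_simplex)
  from b[OF \<open>j < n\<close>] s(2) show ?thesis
  proof (cases rule: face_simplex_split)
    case 1
    with s show ?thesis by blast
  next
    case (2 z)
    define u where "u = b j $ s"
    have upd: "p - b j + w \<in> mixed_cell n A" if "w \<in> face_simplex (A j)" for w
      unfolding p sum_fun_upd[OF \<open>j < n\<close>, of b w, symmetric] mixed_cell_iff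
      using b that by (intro exI[of _ "b(j := w)"]) auto
    have "u *\<^sub>R (p - b j + axis s 1) + (1 - u) *\<^sub>R (p - b j + z)
        = p - b j + (u *\<^sub>R axis s 1 + (1 - u) *\<^sub>R z)"
      by (simp add: algebra_simps)
    also have "\<dots> = p" using 2 by (simp add: u_def)
    finally have "u *\<^sub>R (p - b j + axis s 1) + (1 - u) *\<^sub>R (p - b j + z) \<in> {p}" by simp
    then have "p - b j + axis s 1 \<in> {p}"
      using face_ofD_convex_comb(1)[OF ext upd upd] 2 s axis_in_face_simplex[OF s(1)] unfolding u_def by blast
    then have "b j = axis s 1" by simp
    then show ?thesis using s(1) by blast
  qed
qed

lemma placed_vertex_face_of:
  fixes y :: "nat ^ 'd :: finite"
  assumes "i \<in> J"
  shows "{real_vec y + axis i 1} face_of placed_simplex y J"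
  using face_simplex_face_of[of "{i}" J] assms
  unfolding placed_simplex_def
  by (metis empty_subsetI face_of_translation_eq face_simplex_singleton image_empty image_insert insert_subset)

text \<open>Write each vertex \<open>y + e\<^sub>i\<close> as a sum of vertices \<open>g i j\<close> of the summands. Exchanging one summand
  between two such sums stays in the face, which forces any two of them to differ in a single summand.\<close>

lemma face_of_imp_cell_face:
  fixes A :: "nat \<Rightarrow> 'd :: finite set"
  assumes F: "placed_simplex y J face_of mixed_cell n A" and J: "2 \<le> card J"
  shows "\<exists>j0 f. cell_face n A J y j0 f"
proof -
  have "\<exists>g. \<forall>i\<in>J. (\<forall>j<n. g i j \<in> A j) \<and> real_vec y + axis i 1 = (\<Sum>j<n. axis (g i j) 1)"
  proof (intro bchoice ballI)
    fix i assume i: "i \<in> J"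
    have ext: "{real_vec y + axis i 1} face_of mixed_cell n A"
      using placed_vertex_face_of[OF i] F face_of_trans by blast
    then have "real_vec y + axis i 1 \<in> mixed_cell n A" using face_of_imp_subset by blast
    then obtain b where b: "\<And>j. j < n \<Longrightarrow> b j \<in> face_simplex (A j)" "real_vec y + axis i 1 = (\<Sum>j<n. b j)"
      by (auto simp: mixed_cell_iff)
    have "\<forall>j. \<exists>s. j < n \<longrightarrow> s \<in> A j \<and> b j = axis s 1"
      using extreme_point_mixed_cell[OF ext b] by blast
    then obtain g where g: "\<And>j. j < n \<Longrightarrow> g j \<in> A j \<and> b j = axis (g j) 1" by metis
    then show "\<exists>g. (\<forall>j<n. g j \<in> A j) \<and> real_vec y + axis i 1 = (\<Sum>j<n. axis (g j) 1)"
      using b(2) by (intro exI[of _ g]) auto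
  qed
  then obtain g where g: "\<And>i j. i \<in> J \<Longrightarrow> j < n \<Longrightarrow> g i j \<in> A j"
    and gs: "\<And>i. i \<in> J \<Longrightarrow> real_vec y + axis i 1 = (\<Sum>j<n. axis (g i j) 1)"
    by blast
  have vertex: "real_vec y + axis i 1 \<in> placed_simplex y J" if "i \<in> J" for i
    using that by (auto simp: placed_simplex_def intro: axis_in_face_simplex)
  \<comment> \<open>The exchange yields
    \<open>y + axis i 1 - axis (g i j) 1 + axis (g i' j) 1\<close>. Relative to \<open>y\<close> its
    coordinate at \<open>g i j\<close> would be negative unless \<open>g i j = i\<close>.\<close>
  have same: "g i j = i" if "i \<in> J" "i' \<in> J" "j < n" "g i j \<noteq> g i' j" for i i' j
  proof -
    have "(\<Sum>l<n. axis (g i l) (1 :: real)) - axis (g i j) 1 + axis (g i' j) 1 \<in> placed_simplex y J"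
      by (rule face_swap[OF F, of "\<lambda>j. axis (g i j) 1" "\<lambda>j. axis (g i' j) 1"])
        (use that g gs vertex in \<open>auto simp flip: gs intro: axis_in_face_simplex\<close>)
    then have "axis i (1::real) - axis (g i j) 1 + axis (g i' j) 1 \<in> face_simplex J"
      by (simp add: placed_simplex_iff algebra_simps flip: gs[OF that(1)])
    then have "0 \<le> (axis i (1::real) - axis (g i j) 1 + axis (g i' j) 1) $ g i j"
      by (simp only: face_simplex_altdef mem_Collect_eq)
    then show ?thesis using that(4) by (auto simp: axis_nth_if split: if_splits)
  qed
  have one: "\<exists>j<n. g i j \<noteq> g i' j" if "i \<in> J" "i' \<in> J" "i \<noteq> i'" for i i'
  proof (rule ccontr)
    assume "\<not> ?thesis"
    then have "(\<Sum>j<n. axis (g i j) (1::real)) = (\<Sum>j<n. axis (g i' j) 1)"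
      by (intro sum.cong) auto
    with that show False by (simp flip: gs)
  qed
  have only: "j = j'" if ii: "i \<in> J" "i' \<in> J" and jj: "j < n" "j' < n" "g i j \<noteq> g i' j" "g i j' \<noteq> g i' j'" for i i' j j'
  proof (rule ccontr)
    assume "j \<noteq> j'"
    let ?D = "{l. l < n \<and> g i l \<noteq> g i' l}"
    have ne: "i \<noteq> i'" using jj by auto
    have "1 = (real_vec y + axis i 1) $ i - (real_vec y + axis i' 1) $ i"
      using ne by (simp add: axis_nth_if)
    also have "\<dots> = (\<Sum>l<n. (axis (g i l) (1::real) - axis (g i' l) 1) $ i)"
      by (simp only: gs ii sum_component sum_subtractf vector_minus_component)
    also have "\<dots> = (\<Sum>l\<in>?D. (axis (g i l) (1::real) - axis (g i' l) 1) $ i)"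
      by (intro sum.mono_neutral_right) auto
    also have "\<dots> = (\<Sum>l\<in>?D. 1)"
    proof (intro sum.cong refl)
      fix l assume "l \<in> ?D"
      then have "g i l = i" "g i' l = i'" using same[OF ii, of l] same[OF ii(2,1), of l] by auto
      then show "(axis (g i l) (1::real) - axis (g i' l) 1) $ i = 1" using ne by (simp add: axis_nth_if)
    qed
    finally have "card ?D = 1" by simp
    moreover have "card {j, j'} \<le> card ?D" using jj by (intro card_mono) auto
    ultimately show False using \<open>j \<noteq> j'\<close> by simp
  qed
  obtain i1 i2 where i12: "i1 \<in> J" "i2 \<in> J" "i1 \<noteq> i2"
    using J card_le_Suc0_iff_eq[of J] by fastforce
  obtain j0 where j0: "j0 < n" "g i1 j0 \<noteq> g i2 j0" using one[OF i12] by blast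
  \<comment> \<open>Otherwise \<open>same\<close> would make \<open>g i j0\<close> agree with both
    \<open>g i1 j0\<close> and \<open>g i2 j0\<close>, which differ.\<close>
  have gj0: "g i j0 = i" if i: "i \<in> J" for i
  proof (cases "i = i1")
    case True
    then show ?thesis using same[of i1 i2 j0] i12 j0 by auto
  next
    case False
    show ?thesis
    proof (rule ccontr)
      assume "g i j0 \<noteq> i"
      then have "g i j0 = g i1 j0" "g i j0 = g i2 j0"
        using same[of i i1 j0] same[of i i2 j0] i12 i j0 by auto
      with j0 show False by simp
    qed
  qed
  have "J \<subseteq> A j0" using gj0 g j0 by (metis subsetI)
  moreover have "y = (\<Sum>j\<in>{..<n} - {j0}. axis (g i1 j) 1)"
  proof -
    have "real_vec y + axis i1 1 = axis (g i1 j0) 1 + (\<Sum>j\<in>{..<n} - {j0}. axis (g i1 j) 1)"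
      using gs[OF i12(1)] j0 by (simp add: sum.remove)
    then have "real_vec y = real_vec (\<Sum>j\<in>{..<n} - {j0}. axis (g i1 j) 1)"
      using gj0 i12 by (simp add: real_vec_sum)
    then show ?thesis by simp
  qed
  ultimately show ?thesis using g i12 j0 unfolding cell_face_def by blast
qed

text \<open>An edge of \<open>J\<close> lies in both \<open>A j1\<close> and \<open>A j2\<close>, so
  \<open>j1 = j2\<close>. The equation then gives two decompositions of one vertex, and comparing
  their summands at \<open>j1\<close> yields \<open>a = b\<close>.\<close>

lemma cell_face_same_cell:
  fixes A :: "nat \<Rightarrow> 'd :: finite set"
  assumes d: "direct_cell n A" and c1: "cell_face n A K y1 j1 f1" and c2: "cell_face n A J y2 j2 f2"
    and J: "J \<subseteq> K" "2 \<le> card J" and ab: "a \<in> K" "b \<in> K" 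
    and eq: "y1 + axis a 1 = y2 + axis b 1"
  shows "a = b"
proof -
  obtain u v where uv: "u \<in> J" "v \<in> J" "u \<noteq> v"
    using J(2) card_le_Suc0_iff_eq[of J] by fastforce
  have [simp]: "j2 = j1"
    using direct_cell_disjoint_pairs[OF d, of j1 j2 u v] c1 c2 uv J unfolding cell_face_def by blast
  let ?b = "\<lambda>j. if j = j1 then axis a 1 else axis (f1 j) (1 :: real)"
  let ?c = "\<lambda>j. if j = j1 then axis b 1 else axis (f2 j) (1 :: real)"
  have j1: "j1 < n" using c1 by (simp add: cell_face_def)
  have "real_vec (y1 + axis a 1) = (\<Sum>j<n. ?b j)" "real_vec (y2 + axis b 1) = (\<Sum>j<n. ?c j)"
    using c1 c2 j1 by (simp_all add: cell_face_def real_vec_add real_vec_sum sum.remove[of _ j1])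
  with eq have "(\<Sum>j<n. ?b j) = (\<Sum>j<n. ?c j)" by simp
  then have "?b j1 = ?c j1"
    by (rule direct_cell_unique[OF d, rotated 2])
      (use c1 c2 ab j1 in \<open>auto simp: cell_face_def intro!: axis_in_face_simplex\<close>)
  then show ?thesis by simp
qed

text \<open>A reachability argument. Let \<open>R\<close> be the coordinates reachable from
  \<open>k\<close> by changing vertices in summands other than \<open>j0\<close>. If
  \<open>R\<close> missed \<open>J\<close>, then \<open>y\<close> would minimize the sum of the
  \<open>R\<close>-coordinates over the cell up to the nonnegative share of \<open>j0\<close>,
  against \<open>lt\<close>. So a path leads from \<open>k\<close> to some \<open>i \<in> J\<close>,
  and changing the vertices along it trades \<open>axis k 1\<close> for
  \<open>axis i 1\<close>.\<close>

lemma cell_face_descent: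
  fixes A :: "nat \<Rightarrow> 'd :: finite set"
  assumes c: "cell_face n A J y j0 f"
    and p: "p \<in> mixed_cell n A"
    and lt: "\<And>R. k \<in> R \<Longrightarrow> R \<inter> J = {} \<Longrightarrow> (\<Sum>l\<in>R. p $ l) < (\<Sum>l\<in>R. real (y $ l))"
  shows "\<exists>i\<in>J. \<exists>y' f'. cell_face n A J y' j0 f' \<and> y' + axis k 1 = y + axis i 1"
proof -
  let ?I = "{..<n} - {j0}"
  \<comment> \<open>One move replaces \<open>f j\<close> by any vertex of the same summand;
    \<open>L r\<close> holds what at most \<open>r\<close> moves reach.\<close>
  define nxt where "nxt R = R \<union> {s. \<exists>j\<in>?I. f j \<in> R \<and> s \<in> A j}" for R
  define L where "L r = (nxt ^^ r) {k}" for r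
  have L0: "L 0 = {k}" and LS: "L (Suc r) = nxt (L r)" for r by (auto simp: L_def)
  have L_mono: "L r \<subseteq> L r'" if "r \<le> r'" for r r'
    by (rule lift_Suc_mono_le[OF _ that]) (simp add: LS nxt_def)
  have f: "\<And>j. j \<in> ?I \<Longrightarrow> f j \<in> A j" and y: "y = (\<Sum>j\<in>?I. axis (f j) 1)"
    and j0: "j0 < n" and JA: "J \<subseteq> A j0"
    using c by (auto simp: cell_face_def)
  \<comment> \<open>Since an index \<open>j\<close> is altered only at the level where \<open>f j\<close> first appears, the moves along
    a shortest path use every summand at most once.\<close>
  have reach: "\<forall>s\<in>L r. \<exists>f'. (\<forall>j\<in>?I. f' j \<in> A j) \<and>
      (\<Sum>j\<in>?I. axis (f' j) 1) + axis k 1 = y + axis s 1 \<and>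
      (\<forall>j\<in>?I. f' j \<noteq> f j \<longrightarrow> (\<exists>r'<r. f j \<in> L r'))" for r
  proof (induction r)
    case 0
    show ?case using f y by (auto simp: L0 intro!: exI[of _ f])
  next
    case (Suc r)
    show ?case
    proof
      fix s assume s: "s \<in> L (Suc r)"
      show "\<exists>f'. (\<forall>j\<in>?I. f' j \<in> A j) \<and>
          (\<Sum>j\<in>?I. axis (f' j) 1) + axis k 1 = y + axis s 1 \<and>
          (\<forall>j\<in>?I. f' j \<noteq> f j \<longrightarrow> (\<exists>r'<Suc r. f j \<in> L r'))"
      proof (cases "s \<in> L r")
        case True
        then show ?thesis using Suc.IH less_SucI by meson
      next
        case False
        then obtain j where j: "j \<in> ?I" "f j \<in> L r" "s \<in> A j"
          using s by (auto simp: LS nxt_def)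
        then obtain f' where f': "\<forall>j\<in>?I. f' j \<in> A j"
          "(\<Sum>j\<in>?I. axis (f' j) 1) + axis k 1 = y + axis (f j) 1"
          "\<forall>j\<in>?I. f' j \<noteq> f j \<longrightarrow> (\<exists>r'<r. f j \<in> L r')"
          using Suc.IH by blast
        have "f j \<notin> L r'" if "r' < r" for r'
        proof
          assume "f j \<in> L r'"
          then have "s \<in> L (Suc r')" using j by (auto simp: LS nxt_def)
          with L_mono[of "Suc r'" r] that False show False by auto
        qed
        then have f'j: "f' j = f j" using f'(3) j(1) by blast
        let ?g = "f'(j := s)"
        have g: "(\<Sum>l\<in>?I. axis (?g l) 1) = axis s 1 + (\<Sum>l\<in>?I - {j}. axis (f' l) (1::nat))"
          using j(1) by (simp add: sum.remove[of ?I j])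
        have f'_sum: "(\<Sum>l\<in>?I. axis (f' l) 1) = axis (f j) 1 + (\<Sum>l\<in>?I - {j}. axis (f' l) (1::nat))"
          using j(1) f'j by (simp add: sum.remove[of ?I j])
        \<comment> \<open>Subtraction of \<open>nat\<close> vectors is avoided by adding
          \<open>axis (f j) 1\<close> to both sides and cancelling it at the end.\<close>
        have "axis (f j) 1 + ((\<Sum>l\<in>?I. axis (?g l) 1) + axis k 1)
            = axis s 1 + ((\<Sum>l\<in>?I. axis (f' l) 1) + axis k (1::nat))"
          unfolding g f'_sum by (simp only: ac_simps)
        also have "\<dots> = axis (f j) 1 + (y + axis s 1)"
          unfolding f'(2) by (simp only: ac_simps)
        finally have "axis (f j) 1 + ((\<Sum>l\<in>?I. axis (?g l) 1) + axis k 1) = axis (f j) 1 + (y + axis s 1)" .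
        then have "(\<Sum>l\<in>?I. axis (?g l) 1) + axis k 1 = y + axis s 1"
          by simp
        moreover have "\<forall>l\<in>?I. ?g l \<in> A l" using f'(1) j by auto
        moreover have "\<forall>l\<in>?I. ?g l \<noteq> f l \<longrightarrow> (\<exists>r'<Suc r. f l \<in> L r')"
          using f'(3) j(2) less_SucI by (metis fun_upd_apply lessI)
        ultimately show ?thesis by blast
      qed
    qed
  qed
  define R where "R = (\<Union>r. L r)"
  have "k \<in> R" using L0 by (auto simp: R_def)
  have "R \<inter> J \<noteq> {}"
  proof
    assume disj: "R \<inter> J = {}"
    obtain b where b: "\<forall>j<n. b j \<in> face_simplex (A j)" "p = (\<Sum>j<n. b j)"
      using p by (auto simp: mixed_cell_iff)
    have AR: "A j \<subseteq> R" if j: "j \<in> ?I" "f j \<in> R" for j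
    proof
      fix s assume "s \<in> A j"
      obtain r where "f j \<in> L r" using j(2) by (auto simp: R_def)
      then have "s \<in> L (Suc r)" using j(1) \<open>s \<in> A j\<close> by (auto simp: LS nxt_def)
      then show "s \<in> R" by (auto simp: R_def)
    qed
    have "(\<Sum>l\<in>R. real (y $ l)) = (\<Sum>l\<in>R. \<Sum>j\<in>?I. axis (f j) (1::real) $ l)"
      using y by (simp add: axis_nth_if if_distrib cong: if_cong)
    also have "\<dots> = (\<Sum>j\<in>?I. \<Sum>l\<in>R. axis (f j) (1::real) $ l)"
      by (rule sum.swap)
    \<comment> \<open>For \<open>f j \<in> R\<close> the closure \<open>AR\<close> makes both sides
      1; otherwise the left side is 0.\<close>
    also have "\<dots> \<le> (\<Sum>j\<in>?I. \<Sum>l\<in>R. b j $ l)"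
    proof (rule sum_mono)
      fix j assume j: "j \<in> ?I"
      then have bj: "b j \<in> face_simplex (A j)" using b by auto
      show "(\<Sum>l\<in>R. axis (f j) (1::real) $ l) \<le> (\<Sum>l\<in>R. b j $ l)"
      proof (cases "f j \<in> R")
        case True
        have "(\<Sum>l\<in>R. b j $ l) = (\<Sum>l\<in>UNIV. b j $ l)"
          using AR[OF j True] bj by (intro sum.mono_neutral_left) (auto simp: face_simplex_altdef)
        then show ?thesis using bj True by (simp add: face_simplex_altdef axis_nth_if)
      next
        case False
        then have "(\<Sum>l\<in>R. axis (f j) (1::real) $ l) = 0" by (intro sum.neutral) (auto simp: axis_nth_if)
        then show ?thesis using bj by (auto simp: face_simplex_altdef intro: sum_nonneg)
      qed
    qed
    also have "\<dots> \<le> (\<Sum>j<n. \<Sum>l\<in>R. b j $ l)"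
      using b by (intro sum_mono2) (auto simp: face_simplex_altdef intro!: sum_nonneg)
    also have "\<dots> = (\<Sum>l\<in>R. p $ l)"
      by (simp add: b(2) sum.swap[of _ R])
    finally show False using lt[OF \<open>k \<in> R\<close> disj] by simp
  qed
  then obtain i r where i: "i \<in> J" "i \<in> L r" by (auto simp: R_def)
  then obtain f' where f': "\<forall>j\<in>?I. f' j \<in> A j" "(\<Sum>j\<in>?I. axis (f' j) 1) + axis k 1 = y + axis i 1"
    using reach by blast
  then show ?thesis using i j0 JA unfolding cell_face_def by blast
qed

section \<open>Full-dimensional simplices and lattice points\<close>

lemma simplex_placed_UNIV: "\<exists>k. k simplex (placed_simplex (y :: nat ^ 'd :: finite) UNIV)"
proof -
  let ?E = "range (\<lambda>i :: 'd. axis i (1 :: real))"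
  have "?E \<subseteq> Basis" by (auto simp: axis_in_Basis_iff)
  then have "independent ?E" using independent_Basis independent_mono by blast
  then have "\<not> affine_dependent ?E" using affine_dependent_imp_dependent by blast
  then have "\<not> affine_dependent ((+) (real_vec y) ` ?E)"
    by (simp add: affine_dependent_translation_eq[symmetric])
  then have "(int (card ((+) (real_vec y) ` ?E)) - 1) simplex (placed_simplex y UNIV)"
    unfolding simplex_def placed_simplex_def face_simplex_def
    by (intro exI[of _ "(+) (real_vec y) ` ?E"]) (simp add: convex_hull_translation)
  then show ?thesis by blast
qed

text \<open>Since \<open>A j0 = UNIV\<close> contains every pair, directness leaves only one element
  in each other \<open>A j\<close>.\<close>

lemma cell_face_UNIV:
  fixes A :: "nat \<Rightarrow> 'd :: finite set"
  assumes d: "direct_cell n A" and c: "cell_face n A UNIV y j0 f"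
  shows "mixed_cell n A = placed_simplex y UNIV"
proof
  show "placed_simplex y UNIV \<subseteq> mixed_cell n A"
    using cell_face_imp_face_of[OF assms] by (rule face_of_imp_subset)
  show "mixed_cell n A \<subseteq> placed_simplex y UNIV"
  proof
    fix x assume "x \<in> mixed_cell n A"
    then obtain b where b: "\<And>j. j < n \<Longrightarrow> b j \<in> face_simplex (A j)" "x = (\<Sum>j<n. b j)"
      by (auto simp: mixed_cell_iff)
    have j0: "j0 < n" "A j0 = UNIV" using c by (auto simp: cell_face_def)
    have "b j = axis (f j) 1" if j: "j \<in> {..<n} - {j0}" for j
    proof -
      have fj: "f j \<in> A j" using c j by (auto simp: cell_face_def)
      have "s = f j" if "s \<in> A j" for s
        by (rule direct_cell_disjoint_pairs[OF d, of j j0]) (use j j0 fj that in auto)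
      then have "A j = {f j}" using fj by blast
      then show ?thesis using b(1)[of j] j by simp
    qed
    then have "x = b j0 + real_vec y"
      using j0 c by (simp add: b(2) cell_face_def real_vec_sum sum.remove[of _ j0])
    then show "x \<in> placed_simplex y UNIV"
      using b(1)[OF j0(1)] j0(2) by (simp add: placed_simplex_iff)
  qed
qed

lemma mixed_cell_vertex_face_of:
  fixes A :: "nat \<Rightarrow> 'd :: finite set"
  assumes "direct_cell n A" "\<And>j. j < n \<Longrightarrow> g j \<in> A j"
  shows "{\<Sum>j<n. axis (g j) 1} face_of mixed_cell n A"
proof -
  have "mixed_cell n (\<lambda>j. {g j}) = {\<Sum>j<n. axis (g j) 1}"
    by (auto simp: mixed_cell_iff intro!: exI[of _ "\<lambda>j. axis (g j) 1"])
  then show ?thesis using mixed_cell_face_of[OF assms(1), of "\<lambda>j. {g j}"] assms(2) by simp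
qed

text \<open>A simplex contains no proper parallelogram of vertices: the segment from
  \<open>p\<close> to \<open>q\<close> is a face through the midpoint of \<open>r\<close> and
  \<open>s\<close>, so it contains \<open>r\<close>, and its only extreme points are its
  ends.\<close>

lemma simplex_diagonals:
  fixes C :: "'a :: euclidean_space set"
  assumes "k simplex C" and ext: "{p} face_of C" "{q} face_of C" "{r} face_of C" "{s} face_of C"
    and eq: "p + q = r + s"
  shows "r = p \<or> r = q"
proof -
  obtain K where K: "\<not> affine_dependent K" "C = convex hull K"
    using assms(1) by (auto simp: simplex_def)
  have "{p, q} \<subseteq> K"
    using ext extreme_point_of_convex_hull unfolding K(2) face_of_singleton by blast
  then have F: "convex hull {p, q} face_of C"
    unfolding K(2) face_of_convex_hull_affine_independent[OF K(1)] by blast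
  have "(1/2) *\<^sub>R r + (1 - 1/2) *\<^sub>R s = (1/2) *\<^sub>R p + (1/2) *\<^sub>R q"
    using eq by (simp flip: scaleR_add_right)
  also have "\<dots> \<in> convex hull {p, q}"
    by (intro convexD) (auto intro: hull_inc)
  finally have mid: "(1/2) *\<^sub>R r + (1 - 1/2) *\<^sub>R s \<in> convex hull {p, q}" .
  have "r \<in> C" "s \<in> C" using ext face_of_imp_subset by blast+
  then have "r \<in> convex hull {p, q}"
    using face_ofD_convex_comb(1)[OF F _ _ mid] by simp
  then have "r extreme_point_of (convex hull {p, q})"
    using ext(3) face_of_imp_subset[OF F] face_of_subset unfolding face_of_singleton[symmetric] by blast
  then show ?thesis by (simp add: extreme_point_of_convex_hull_2)
qed

lemma aff_dim_face_simplex_le: "aff_dim (face_simplex (J :: 'd :: finite set)) \<le> int (card J) - 1"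
proof -
  have "aff_dim (face_simplex J) \<le> int (card ((\<lambda>i. axis i (1::real)) ` J)) - 1"
    unfolding face_simplex_def aff_dim_convex_hull by (intro aff_dim_le_card) auto
  also have "card ((\<lambda>i. axis i (1::real)) ` J) = card J"
    by (intro card_image) (auto simp: inj_on_def)
  finally show ?thesis .
qed

text \<open>For \<open>i \<noteq> l\<close> the vertex \<open>z + axis i 1\<close> has coordinate
  \<open>z $ l\<close> at \<open>l\<close>, which bounds \<open>y $ l\<close> from above; then
  symmetry applies.\<close>

lemma placed_simplex_inj:
  fixes y z :: "nat ^ 'd :: finite"
  assumes "CARD('d) \<ge> 2" "placed_simplex y UNIV = placed_simplex z UNIV"
  shows "y = z"
proof -
  have le: "y $ l \<le> z $ l" if eq: "placed_simplex y UNIV = placed_simplex z UNIV" for y z :: "nat ^ 'd" and l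
  proof -
    have "UNIV \<noteq> {l}" using assms(1) card_1_singleton_iff[of "UNIV :: 'd set"] by auto
    then obtain i where i: "i \<noteq> l" by blast
    have "real_vec z + axis i 1 \<in> placed_simplex y UNIV"
      unfolding eq by (auto simp: placed_simplex_def intro: axis_in_face_simplex)
    then have "real_vec z + axis i 1 - real_vec y \<in> face_simplex UNIV"
      by (simp only: placed_simplex_iff)
    then have "0 \<le> (real_vec z + axis i 1 - real_vec y) $ l"
      by (simp only: face_simplex_altdef mem_Collect_eq)
    then show ?thesis using i by (simp add: axis_nth_if)
  qed
  show ?thesis
    using le[OF assms(2)] le[OF assms(2)[symmetric]] by (simp add: vec_eq_iff antisym)
qed

lemma sum_vec_UNIV_singleton:
  fixes x :: "'b :: comm_monoid_add ^ 'd :: finite"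
  assumes "UNIV = {u}"
  shows "(\<Sum>i\<in>UNIV. x $ i) = x $ u"
  unfolding assms by simp

lemma vec_eqI_UNIV_singleton:
  assumes "UNIV = {u}" "x $ u = z $ u"
  shows "x = z"
  using assms by (metis UNIV_I singletonD vec_eq_iff)

lemma finite_T_points: "finite (T_points m :: (nat ^ 'd :: finite) set)"
proof (rule finite_subset)
  show "T_points m \<subseteq> (\<lambda>g. \<chi> i. g i) ` (UNIV \<rightarrow>\<^sub>E {..m} :: ('d \<Rightarrow> nat) set)"
  proof
    fix x :: "nat ^ 'd" assume x: "x \<in> T_points m"
    have "x $ i \<le> m" for i
      using member_le_sum[of i UNIV "\<lambda>i. x $ i"] x by (auto simp: T_points_def)
    then show "x \<in> (\<lambda>g. \<chi> i. g i) ` (UNIV \<rightarrow>\<^sub>E {..m} :: ('d \<Rightarrow> nat) set)"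
      by (intro image_eqI[of _ _ "\<lambda>i. x $ i"]) (auto simp: PiE_def extensional_def)
  qed
qed (auto intro!: finite_imageI finite_PiE)

subsection \<open>Faces shared by adjacent tiles\<close>

locale mixed_subdivision =
  fixes n :: nat and S :: "(real ^ 'd :: finite) set set"
  assumes n_pos: "n \<ge> 1" and subdivision: "fine_mixed_subdivision n S"
begin

lemma finite_S: "finite S" and Union_S: "\<Union>S = dilated_simplex n"
  using subdivision by (auto simp: fine_mixed_subdivision_def)

lemma face_Int: "C \<in> S \<Longrightarrow> D \<in> S \<Longrightarrow> C \<inter> D face_of C" "C \<in> S \<Longrightarrow> D \<in> S \<Longrightarrow> C \<inter> D face_of D"
  using subdivision by (auto simp: fine_mixed_subdivision_def)

lemma tileE:
  assumes "C \<in> S"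
  obtains A where "C = mixed_cell n A" "direct_cell n A" "\<And>j. j < n \<Longrightarrow> A j \<noteq> {}"
    "(\<Sum>j<n. aff_dim (face_simplex (A j))) = int CARD('d) - 1"
  using assms subdivision fine_mixed_cellE unfolding fine_mixed_subdivision_def by metis

lemma tile_coords: "C \<in> S \<Longrightarrow> x \<in> C \<Longrightarrow> (\<Sum>i\<in>UNIV. x $ i) = real n"
  by (metis tileE mixed_cell_coords(2))

lemma tile_convex: "C \<in> S \<Longrightarrow> convex C"
  by (metis tileE convex_mixed_cell)

lemma tile_closed: "C \<in> S \<Longrightarrow> closed C"
  by (metis tileE closed_mixed_cell)

text \<open>The finitely many closed tiles avoiding \<open>x\<close> also avoid a ball around it, so
  the tile covering a nearby point of the ray contains \<open>x\<close>.\<close>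

lemma tile_along_ray:
  assumes "x \<in> dilated_simplex n" "x + w \<in> dilated_simplex n"
  obtains C t where "C \<in> S" "x \<in> C" "0 < t" "t \<le> 1" "x + t *\<^sub>R w \<in> C"
proof -
  let ?U = "- \<Union>{C \<in> S. x \<notin> C}"
  have "open ?U" using finite_S tile_closed by (intro open_Compl closed_Union) auto
  moreover have "x \<in> ?U" by auto
  ultimately obtain e where e: "0 < e" "ball x e \<subseteq> ?U" using open_contains_ball by meson
  \<comment> \<open>The summand 1 keeps the denominator positive for \<open>w = 0\<close>; the step
    then has length at most \<open>e / 2\<close>, and \<open>min 1\<close> keeps it on the
    segment.\<close>
  define N where "N = norm w + 1"
  define t where "t = min 1 (e / (2 * N))"
  have nw: "0 < N" "norm w \<le> N" using norm_ge_zero[of w] by (auto simp: N_def simp del: norm_ge_zero)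
  have t: "0 < t" "t \<le> 1" using e nw by (auto simp: t_def)
  have "t * norm w \<le> (e / (2 * N)) * N"
    using e t nw by (intro mult_mono) (auto simp: t_def)
  also have "\<dots> = e / 2" using nw by simp
  also have "\<dots> < e" using e by simp
  finally have "x + t *\<^sub>R w \<in> ball x e" using t by (simp add: dist_norm)
  moreover have "x + t *\<^sub>R w \<in> dilated_simplex n"
  proof -
    have "convex (dilated_simplex n :: (real ^ 'd) set)"
      unfolding dilated_simplex_def std_simplex_def by (intro convex_set_sum) auto
    then have "(1 - t) *\<^sub>R x + t *\<^sub>R (x + w) \<in> dilated_simplex n"
      using assms t by (intro convexD) auto
    then show ?thesis by (simp add: algebra_simps)
  qed
  ultimately show ?thesis using e(2) t that Union_S by blast
qed

text \<open>The barycenter puts the placed simplex inside the common face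
  \<open>C \<inter> D\<close>. It is a face of that intersection, hence of \<open>D\<close>.\<close>

lemma face_transfer:
  assumes "C \<in> S" "D \<in> S" "placed_simplex y J face_of C" "real_vec y + bary J \<in> D" "J \<noteq> {}"
  shows "placed_simplex y J face_of D"
proof -
  have "real_vec y + bary J \<in> C"
    using face_of_imp_subset[OF assms(3)] bary_in[OF assms(5)] unfolding placed_simplex_def by blast
  then have "placed_simplex y J \<subseteq> C \<inter> D"
    using placed_simplex_subset_face[OF face_Int(1)[OF assms(1,2)] face_of_imp_subset[OF assms(3)]] assms(4,5)
    by blast
  then have "placed_simplex y J face_of C \<inter> D"
    by (intro face_of_subset[OF assms(3)]) auto
  then show ?thesis using face_Int(2)[OF assms(1,2)] face_of_trans by blast
qed

text \<open>Two sets \<open>J \<subseteq> K\<close> allow both uses: \<open>K = J\<close> in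
  \<open>adj_unique\<close> and \<open>K = insert k J\<close> in
  \<open>no_adj_above_simplex\<close>.\<close>

lemma tile_face_same_tile:
  assumes "C \<in> S" "placed_simplex y1 K face_of C" "placed_simplex y2 J face_of C" 
    "J \<subseteq> K" "2 \<le> card J" "a \<in> K" "b \<in> K" "y1 + axis a 1 = y2 + axis b 1"
  shows "a = b"
proof -
  obtain A where A: "C = mixed_cell n A" "direct_cell n A" using assms(1) by (rule tileE)
  have "2 \<le> card K" using assms(4,5) card_mono[of K J] by simp
  then show ?thesis
    using face_of_imp_cell_face[of y1 K n A] face_of_imp_cell_face[of y2 J n A] A assms
      cell_face_same_cell[OF A(2)] by metis
qed

definition adj :: "'d set \<Rightarrow> nat ^ 'd \<Rightarrow> nat ^ 'd \<Rightarrow> bool" where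
  "adj J y y' \<longleftrightarrow> (\<exists>C\<in>S. placed_simplex y J face_of C \<and> placed_simplex y' J face_of C)"

lemma adj_commute: "adj J y y' \<longleftrightarrow> adj J y' y"
  by (auto simp: adj_def)

text \<open>After moving its start inside \<open>y + \<Delta>\<^sub>J\<close>, a segment to \<open>y2 + \<Delta>\<^sub>J\<close> crosses the segment from the
  barycenter of \<open>y + \<Delta>\<^sub>J\<close> to that of \<open>y1 + \<Delta>\<^sub>J\<close>, so all three faces lie in one tile.\<close>

lemma adj_unique:
  assumes "adj J y y1" "adj J y y2" "2 \<le> card J" "a \<in> J" "b \<in> J" and eq: "y1 + axis b 1 = y2 + axis a 1"
  shows "y1 = y2"
proof -
  obtain C1 where C1: "C1 \<in> S" "placed_simplex y J face_of C1" "placed_simplex y1 J face_of C1"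
    using assms(1) by (auto simp: adj_def)
  obtain C2 where C2: "C2 \<in> S" "placed_simplex y J face_of C2" "placed_simplex y2 J face_of C2"
    using assms(2) by (auto simp: adj_def)
  have J: "J \<noteq> {}" using assms by auto
  let ?c = "real (card J)"
  \<comment> \<open>Chosen to solve \<open>(1 - s) / card J = s\<close>: perturbing the start by
    \<open>1 / card J\<close> then compensates the displacement of the endpoint exactly at the
    crossing point.\<close>
  define s where "s = 1 / (?c + 1)"
  have c: "0 < ?c" using assms(3) by simp
  have s: "0 < s" "s < 1" "(1 - s) * (1 / ?c) = s" using c by (auto simp: s_def field_simps)
  have in1: "real_vec y + bary J \<in> C1" "real_vec y1 + bary J \<in> C1" "real_vec y2 + bary J \<in> C2"
    using C1(2,3)[THEN face_of_imp_subset] C2(3)[THEN face_of_imp_subset] bary_in[OF J]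
    unfolding placed_simplex_def by blast+
  have in2: "real_vec y + (bary J + (1 / ?c) *\<^sub>R (axis a 1 - axis b 1)) \<in> C2"
    using face_of_imp_subset[OF C2(2)] bary_perturb[OF assms(4,5)] unfolding placed_simplex_def by blast
  have "real_vec (y1 + axis b 1) = real_vec (y2 + axis a 1)" using eq by simp
  then have y1: "real_vec y1 = real_vec y2 + (axis a 1 - axis b 1)"
    by (simp add: real_vec_add algebra_simps)
  have "s *\<^sub>R (real_vec y1 + bary J) + (1 - s) *\<^sub>R (real_vec y + bary J)
     = s *\<^sub>R (real_vec y2 + bary J) + (1 - s) *\<^sub>R (real_vec y + bary J) + s *\<^sub>R (axis a 1 - axis b 1)"
    by (simp add: y1 algebra_simps)
  also have "s *\<^sub>R (axis a 1 - axis b 1) = (1 - s) *\<^sub>R (1 / ?c) *\<^sub>R (axis a (1::real) - axis b 1)"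
    using s(3) by (simp only: scaleR_scaleR)
  also have "s *\<^sub>R (real_vec y2 + bary J) + (1 - s) *\<^sub>R (real_vec y + bary J) + \<dots>
     = s *\<^sub>R (real_vec y2 + bary J) + (1 - s) *\<^sub>R (real_vec y + (bary J + (1 / ?c) *\<^sub>R (axis a 1 - axis b 1)))"
    by (simp only: scaleR_add_right add.assoc)
  also have "\<dots> \<in> C2"
    using tile_convex[OF C2(1)] in1 in2 s by (intro convexD) auto
  finally have q: "s *\<^sub>R (real_vec y1 + bary J) + (1 - s) *\<^sub>R (real_vec y + bary J) \<in> C1 \<inter> C2"
    using tile_convex[OF C1(1)] in1 s by (auto intro!: convexD)
  have "real_vec y1 + bary J \<in> C1 \<inter> C2"
    by (rule face_ofD_convex_comb(1)[OF face_Int(1)[OF C1(1) C2(1)] in1(2,1) q s(1,2)])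
  then have "placed_simplex y1 J face_of C2"
    using face_transfer[OF C1(1) C2(1) C1(3) _ J] by blast
  then have "b = a"
    using tile_face_same_tile[OF C2(1) _ C2(3) _ assms(3,5,4) eq] by blast
  with eq show ?thesis by simp
qed

text \<open>The segment between the barycenters of \<open>y + \<Delta>\<^sub>J\<close> and
  \<open>y1 + \<Delta>\<^sub>J\<close> starts in the direction \<open>axis k 1 - axis i 1\<close>,
  hence runs inside the larger simplex in \<open>C1\<close> at first. This makes
  \<open>y1 + \<Delta>\<^sub>J\<close> a face of \<open>C1\<close> as well, and directness forces
  \<open>k = i\<close>.\<close>

lemma no_adj_above_simplex:
  assumes C1: "C1 \<in> S" "placed_simplex y (insert k J) face_of C1" and "adj J y y1" 
    and J: "2 \<le> card J" "i \<in> J" "k \<notin> J" and eq: "y1 + axis i 1 = y + axis k 1"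
  shows False
proof -
  obtain C2 where C2: "C2 \<in> S" "placed_simplex y J face_of C2" "placed_simplex y1 J face_of C2"
    using assms by (auto simp: adj_def)
  have J0: "J \<noteq> {}" using J by auto
  let ?c = "real (card J)"
  \<comment> \<open>The bound \<open>s \<le> 1 / card J\<close> keeps the coordinate at
    \<open>i\<close> nonnegative.\<close>
  define s where "s = 1 / (?c + 1)"
  have c: "0 < ?c" using J by simp
  have s: "0 < s" "s < 1" "s \<le> 1 / ?c" using c by (auto simp: s_def field_simps)
  have in2: "real_vec y + bary J \<in> C2" "real_vec y1 + bary J \<in> C2"
    using C2(2,3)[THEN face_of_imp_subset] bary_in[OF J0] unfolding placed_simplex_def by blast+
  have "real_vec (y1 + axis i 1) = real_vec (y + axis k 1)" using eq by simp
  then have y1: "real_vec y1 = real_vec y + (axis k 1 - axis i 1)"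
    by (simp add: real_vec_add algebra_simps)
  have "(\<Sum>l\<in>UNIV. bary J $ l) = 1"
    using bary_in[OF J0] by (auto simp: face_simplex_altdef)
  then have "bary J + s *\<^sub>R (axis k 1 - axis i 1) \<in> face_simplex (insert k J)"
    using s J by (auto simp: face_simplex_altdef sum.distrib sum_subtractf bary_nth axis_nth_if
        simp flip: sum_distrib_left)
  then have "real_vec y + (bary J + s *\<^sub>R (axis k 1 - axis i 1)) \<in> C1"
    using face_of_imp_subset[OF C1(2)] unfolding placed_simplex_def by blast
  also have "real_vec y + (bary J + s *\<^sub>R (axis k 1 - axis i 1))
      = s *\<^sub>R (real_vec y1 + bary J) + (1 - s) *\<^sub>R (real_vec y + bary J)"
    by (simp add: y1 algebra_simps)
  finally have q: "s *\<^sub>R (real_vec y1 + bary J) + (1 - s) *\<^sub>R (real_vec y + bary J) \<in> C1 \<inter> C2"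
    using tile_convex[OF C2(1)] in2 s by (auto intro!: convexD)
  have "real_vec y1 + bary J \<in> C1 \<inter> C2"
    by (rule face_ofD_convex_comb(1)[OF face_Int(2)[OF C1(1) C2(1)] in2(2,1) q s(1,2)])
  then have "placed_simplex y1 J face_of C1"
    using face_transfer[OF C2(1) C1(1) C2(3) _ J0] by blast
  then have "k = i"
    using tile_face_same_tile[OF C1 _ subset_insertI J(1) insertI1 insertI2[OF J(2)] eq[symmetric]] by blast
  with J show False by simp
qed

subsection \<open>Counting locations\<close>

definition locations :: "'d set \<Rightarrow> (nat ^ 'd) set" where
  "locations J = {y. \<exists>C\<in>S. placed_simplex y J face_of C}"

text \<open>Freezing the coordinates off \<open>J\<close> confines the points to a line when
  \<open>card J = 2\<close>. For \<open>J = UNIV\<close> nothing is frozen, and the set consists of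
  all locations in the translate determined by \<open>a\<close>.\<close>

definition locations_above :: "'d set \<Rightarrow> nat ^ 'd \<Rightarrow> (nat ^ 'd) set" where
  "locations_above J a = {y \<in> locations J. (\<forall>i\<in>J. a $ i \<le> y $ i) \<and> (\<forall>i. i \<notin> J \<longrightarrow> y $ i = a $ i)}"

lemma locations_T_points:
  assumes "J \<noteq> {}" "y \<in> locations J"
  shows "y \<in> T_points n"
proof -
  obtain i C where i: "i \<in> J" and C: "C \<in> S" "placed_simplex y J face_of C" 
    using assms by (auto simp: locations_def)
  then have "real_vec y + axis i 1 \<in> C"
    using face_of_imp_subset[OF C(2)] by (auto simp: placed_simplex_def intro: axis_in_face_simplex)
  then have "(\<Sum>l\<in>UNIV. (real_vec y + axis i 1) $ l) = real n"
    using tile_coords C by blast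
  then have "real ((\<Sum>l\<in>UNIV. y $ l) + 1) = real n"
    by (simp add: sum.distrib)
  then show ?thesis unfolding T_points_def of_nat_eq_iff by simp
qed

lemma placed_bary_in_dilated:
  assumes "J \<noteq> {}" "y \<in> T_points n"
  shows "real_vec y + bary J \<in> dilated_simplex n"
proof (rule in_dilated_simplex[OF _ _ n_pos])
  have b: "(\<Sum>l\<in>UNIV. bary J $ l) = 1" "\<And>l. 0 \<le> bary J $ l"
    using bary_in[OF assms(1)] by (auto simp: face_simplex_altdef)
  then show "0 \<le> (real_vec y + bary J) $ i" for i by simp
  have "real ((\<Sum>l\<in>UNIV. y $ l) + 1) = real n"
    using assms(2) by (simp add: T_points_def)
  then show "(\<Sum>l\<in>UNIV. (real_vec y + bary J) $ l) = real n"
    using b by (simp add: sum.distrib)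
qed

text \<open>A short step towards \<open>bary J - axis k 1\<close> stays in a tile having
  \<open>y + \<Delta>\<^sub>J\<close> as a face and lowers the weight at \<open>k\<close>;
  \<open>cell_face_descent\<close> then supplies the neighbour.\<close>

lemma ex_adj_descent:
  assumes y: "y \<in> locations J" and J: "2 \<le> card J" "k \<notin> J" and yk: "0 < y $ k"
  shows "\<exists>i\<in>J. \<exists>y'. y' + axis k 1 = y + axis i 1 \<and> adj J y y'"
proof -
  have J0: "J \<noteq> {}" using J by auto
  have yT: "y \<in> T_points n" using locations_T_points[OF J0 y] .
  \<comment> \<open>Since \<open>y $ k\<close> is at least 1, the far end of this ray still has
    nonnegative coordinates.\<close>
  let ?w = "bary J - axis k 1"
  have b: "(\<Sum>l\<in>UNIV. bary J $ l) = 1" "\<And>l. 0 \<le> bary J $ l" "\<And>l. l \<notin> J \<Longrightarrow> bary J $ l = 0"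
    using bary_in[OF J0] by (auto simp: face_simplex_altdef)
  have w: "real_vec y + bary J + ?w \<in> dilated_simplex n"
  proof (rule in_dilated_simplex[OF _ _ n_pos])
    show "0 \<le> (real_vec y + bary J + ?w) $ i" for i
      using b(2)[of i] yk by (auto simp: axis_nth_if)
    have "real ((\<Sum>l\<in>UNIV. y $ l) + 1) = real n"
      using yT by (simp add: T_points_def)
    then show "(\<Sum>l\<in>UNIV. (real_vec y + bary J + ?w) $ l) = real n"
      using b by (simp add: sum.distrib sum_subtractf flip: sum_distrib_left)
  qed
  obtain C t where C: "C \<in> S" "real_vec y + bary J \<in> C" and t: "0 < t" "t \<le> 1" 
     and pC: "real_vec y + bary J + t *\<^sub>R ?w \<in> C"
    using tile_along_ray[OF placed_bary_in_dilated[OF J0 yT] w] by metis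
  have yC: "placed_simplex y J face_of C"
    using y C face_transfer[OF _ C(1) _ C(2) J0] by (auto simp: locations_def)
  obtain A where A: "C = mixed_cell n A" "direct_cell n A" using C(1) by (rule tileE)
  obtain j0 f where c: "cell_face n A J y j0 f"
    using face_of_imp_cell_face[OF yC[unfolded A(1)] J(1)] by blast
  have "\<exists>i\<in>J. \<exists>y' f'. cell_face n A J y' j0 f' \<and> y' + axis k 1 = y + axis i 1"
  proof (rule cell_face_descent[OF c pC[unfolded A(1)]])
    fix R assume R: "k \<in> R" "R \<inter> J = {}"
    \<comment> \<open>As \<open>bary J\<close> vanishes on \<open>R\<close>, only the loss of
      \<open>t\<close> at \<open>k\<close> remains.\<close>
    have "(\<Sum>l\<in>R. (real_vec y + bary J + t *\<^sub>R ?w) $ l) = (\<Sum>l\<in>R. real (y $ l) - t * axis k 1 $ l)"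
    proof (rule sum.cong[OF refl])
      fix l assume "l \<in> R"
      then have "bary J $ l = 0" using b R by auto
      then show "(real_vec y + bary J + t *\<^sub>R ?w) $ l = real (y $ l) - t * axis k 1 $ l"
        by simp
    qed
    also have "\<dots> = (\<Sum>l\<in>R. real (y $ l)) - t"
      using R by (simp add: sum_subtractf axis_nth_if if_distrib[of "(*) _"] cong: if_cong)
    finally show "(\<Sum>l\<in>R. (real_vec y + bary J + t *\<^sub>R ?w) $ l) < (\<Sum>l\<in>R. real (y $ l))"
      using t by simp
  qed
  then obtain i y' f' where "i \<in> J" "cell_face n A J y' j0 f'" "y' + axis k 1 = y + axis i 1" by blast
  moreover from this have "adj J y y'"
    unfolding adj_def using C(1) yC A cell_face_imp_face_of[OF A(2)] by blast
  ultimately show ?thesis by blast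
qed

text \<open>The support condition keeps the ascent inside the boundary face spanned by \<open>insert k J\<close>; at other
  levels a predecessor need not exist.\<close>

lemma ex_adj_ascent:
  assumes y: "y \<in> locations J" and J: "2 \<le> card J" "k \<notin> J" 
    and supp: "\<And>l. l \<notin> insert k J \<Longrightarrow> y $ l = 0" and not_up: "y \<notin> locations (insert k J)"
  shows "\<exists>i\<in>J. \<exists>y'. y' + axis i 1 = y + axis k 1 \<and> adj J y y'"
proof -
  have J0: "J \<noteq> {}" using J by auto
  have yT: "y \<in> T_points n" using locations_T_points[OF J0 y] .
  let ?w = "axis k 1 - bary J"
  have b: "(\<Sum>l\<in>UNIV. bary J $ l) = 1" "\<And>l. 0 \<le> bary J $ l" "\<And>l. l \<notin> J \<Longrightarrow> bary J $ l = 0"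
    using bary_in[OF J0] by (auto simp: face_simplex_altdef)
  have w: "real_vec y + bary J + ?w \<in> dilated_simplex n"
  proof (rule in_dilated_simplex[OF _ _ n_pos])
    show "0 \<le> (real_vec y + bary J + ?w) $ i" for i
      by (auto simp: axis_nth_if)
    have "real ((\<Sum>l\<in>UNIV. y $ l) + 1) = real n"
      using yT by (simp add: T_points_def)
    then show "(\<Sum>l\<in>UNIV. (real_vec y + bary J + ?w) $ l) = real n"
      using b by (simp add: sum.distrib)
  qed
  obtain C t where C: "C \<in> S" "real_vec y + bary J \<in> C" and t: "0 < t" "t \<le> 1" 
     and pC: "real_vec y + bary J + t *\<^sub>R ?w \<in> C"
    using tile_along_ray[OF placed_bary_in_dilated[OF J0 yT] w] by metis
  have yC: "placed_simplex y J face_of C"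
    using y C face_transfer[OF _ C(1) _ C(2) J0] by (auto simp: locations_def)
  obtain A where A: "C = mixed_cell n A" "direct_cell n A" using C(1) by (rule tileE)
  obtain j0 f where c: "cell_face n A J y j0 f"
    using face_of_imp_cell_face[OF yC[unfolded A(1)] J(1)] by blast
  let ?I = "{..<n} - {j0}"
  have f: "\<And>j. j \<in> ?I \<Longrightarrow> f j \<in> A j" and y_eq: "y = (\<Sum>j\<in>?I. axis (f j) 1)"
    and j0: "j0 < n" and JA: "J \<subseteq> A j0"
    using c by (auto simp: cell_face_def)
  have "k \<notin> A j0"
  proof
    assume "k \<in> A j0"
    then have "cell_face n A (insert k J) y j0 f" using c by (auto simp: cell_face_def)
    then show False
      using cell_face_imp_face_of[OF A(2)] A(1) C(1) not_up by (auto simp: locations_def)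
  qed
  \<comment> \<open>If no other summand could move its vertex to \<open>k\<close>, then
    \<open>y $ k\<close> would be the maximum of that coordinate over the tile, but the point on the
    ray exceeds it by \<open>t\<close>.\<close>
  have "\<exists>j\<in>?I. f j \<noteq> k \<and> k \<in> A j"
  proof (rule ccontr)
    assume no: "\<not> ?thesis"
    obtain \<beta> where \<beta>: "\<And>j. j < n \<Longrightarrow> \<beta> j \<in> face_simplex (A j)" 
      "real_vec y + bary J + t *\<^sub>R ?w = (\<Sum>j<n. \<beta> j)"
      using pC unfolding A(1) mixed_cell_iff by blast
    have "real (y $ k) + t = (real_vec y + bary J + t *\<^sub>R ?w) $ k"
      using b J by simp
    also have "\<dots> = \<beta> j0 $ k + (\<Sum>j\<in>?I. \<beta> j $ k)"
      using j0 by (simp add: \<beta>(2) sum.remove)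
    also have "\<beta> j0 $ k = 0" using \<open>k \<notin> A j0\<close> \<beta>(1)[OF j0] by (auto simp: face_simplex_altdef)
    also have "(\<Sum>j\<in>?I. \<beta> j $ k) \<le> (\<Sum>j\<in>?I. axis (f j) 1 $ k)"
    proof (rule sum_mono)
      fix j assume j: "j \<in> ?I"
      then have bj: "\<beta> j \<in> face_simplex (A j)" using \<beta> by auto
      then have "\<beta> j $ k \<le> (\<Sum>l\<in>UNIV. \<beta> j $ l)"
        by (intro member_le_sum) (auto simp: face_simplex_altdef)
      then show "\<beta> j $ k \<le> axis (f j) 1 $ k"
        using no j bj by (auto simp: axis_nth_if face_simplex_altdef)
    qed
    also have "\<dots> = real (y $ k)" by (simp add: y_eq axis_nth_if if_distrib cong: if_cong)
    finally show False using t by simp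
  qed
  then obtain j where j: "j \<in> ?I" "f j \<noteq> k" "k \<in> A j" by blast
  have y_rem: "y = axis (f j) 1 + (\<Sum>l\<in>?I - {j}. axis (f l) 1)"
    using j(1) by (simp add: y_eq sum.remove[of ?I j])
  then have "y $ f j \<noteq> 0" by (simp add: axis_nth_if)
  \<comment> \<open>\<open>f j\<close> lies in the support of \<open>y\<close> and differs from
    \<open>k\<close>, so the support condition leaves only \<open>J\<close>.\<close>
  then have fj: "f j \<in> J" using supp[of "f j"] j by auto
  define y' where "y' = (\<Sum>l\<in>?I. axis ((f(j := k)) l) (1 :: nat))"
  have y'_rem: "y' = axis k 1 + (\<Sum>l\<in>?I - {j}. axis (f l) 1)"
    using j(1) by (simp add: y'_def sum.remove[of ?I j])
  have "y' + axis (f j) 1 = y + axis k 1"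
    unfolding y_rem y'_rem by (simp only: ac_simps)
  moreover have "cell_face n A J y' j0 (f(j := k))"
    using f j j0 JA by (auto simp: cell_face_def y'_def)
  then have "adj J y y'"
    unfolding adj_def using C(1) yC A cell_face_imp_face_of[OF A(2)] by blast
  ultimately show ?thesis using fj by blast
qed

lemma locations_mono:
  assumes "J \<subseteq> K"
  shows "locations K \<subseteq> locations J"
proof -
  have "placed_simplex y J face_of placed_simplex y K" for y
    unfolding placed_simplex_def by (simp add: face_simplex_face_of[OF assms])
  then show ?thesis unfolding locations_def using face_of_trans by blast
qed

text \<open>Both sets sit inside a common set \<open>X\<close> where \<open>k\<close> is only
  bounded below: \<open>Z\<close> is its level \<open>y $ k = a $ k\<close>, and \<open>U\<close>
  collects the simplices that extend to \<open>k\<close>. Descent injects \<open>X - Z\<close> into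
  \<open>X - U\<close>; for \<open>a = 0\<close> ascent gives an injection back.\<close>

lemma card_locations_above_insert:
  assumes J: "2 \<le> card J" "k \<notin> J"
  shows "card (locations_above (insert k J) a) \<le> card (locations_above J a)"
    and "a = 0 \<Longrightarrow> card (locations_above (insert k J) a) = card (locations_above J a)"
proof -
  have J0: "J \<noteq> {}" using J by auto
  define X where "X = {y \<in> locations J. (\<forall>i\<in>insert k J. a $ i \<le> y $ i) \<and> (\<forall>i. i \<notin> insert k J \<longrightarrow> y $ i = a $ i)}"
  define U where "U = locations_above (insert k J) a"
  define Z where "Z = locations_above J a"
  have Z: "Z = {y \<in> X. y $ k = a $ k}"
    using J by (auto simp: Z_def X_def locations_above_def)
  have U: "U = {y \<in> X. y \<in> locations (insert k J)}"
    using locations_mono[of J "insert k J"] by (auto simp: U_def X_def locations_above_def)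
  have fin: "finite X"
    by (rule finite_subset[OF _ finite_T_points[of n]]) (use locations_T_points[OF J0] in \<open>auto simp: X_def\<close>)
  have adj_X: "y' \<in> locations J" if "adj J y y'" for y y'
    using that by (auto simp: adj_def locations_def)
  have "\<forall>y\<in>X - Z. \<exists>y'. \<exists>i\<in>J. y' + axis k 1 = y + axis i 1 \<and> adj J y y'"
  proof
    fix y assume "y \<in> X - Z"
    then have "y \<in> locations J" "0 < y $ k" by (auto simp: X_def Z)
    then show "\<exists>y'. \<exists>i\<in>J. y' + axis k 1 = y + axis i 1 \<and> adj J y y'" 
      using ex_adj_descent[OF _ J] by blast
  qed
  then obtain \<delta> where \<delta>: "\<And>y. y \<in> X - Z \<Longrightarrow> \<exists>i\<in>J. \<delta> y + axis k 1 = y + axis i 1 \<and> adj J y (\<delta> y)"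
    by metis
  have nth: "y' $ l + (if l = k then 1 else 0) = y $ l + (if l = i then 1 else 0)"
    if "y' + axis k 1 = y + axis i (1::nat)" for y y' i l
    using arg_cong[OF that, of "\<lambda>v. v $ l"] by (auto simp: axis_nth_if split: if_splits)
  have "card (X - Z) \<le> card (X - U)"
  proof (rule card_inj_on_le[of \<delta>])
    show "inj_on \<delta> (X - Z)"
    proof (rule inj_onI)
      fix y1 y2 assume y: "y1 \<in> X - Z" "y2 \<in> X - Z" "\<delta> y1 = \<delta> y2"
      obtain i1 where i1: "i1 \<in> J" "\<delta> y1 + axis k 1 = y1 + axis i1 1" "adj J y1 (\<delta> y1)"
        using \<delta>[OF y(1)] by blast
      obtain i2 where i2: "i2 \<in> J" "\<delta> y2 + axis k 1 = y2 + axis i2 1" "adj J y2 (\<delta> y2)"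
        using \<delta>[OF y(2)] by blast
      \<comment> \<open>Both points are neighbours of the common image and differ by
        \<open>axis i2 1 - axis i1 1\<close>, which is the situation of
        \<open>adj_unique\<close>.\<close>
      show "y1 = y2"
        by (rule adj_unique[of J "\<delta> y1" y1 y2 i2 i1]) (use i1 i2 y J adj_commute in auto)
    qed
    show "\<delta> ` (X - Z) \<subseteq> X - U"
    proof
      fix y' assume "y' \<in> \<delta> ` (X - Z)"
      then obtain y where y: "y \<in> X - Z" "y' = \<delta> y" by auto
      then obtain i where i: "i \<in> J" "y' + axis k 1 = y + axis i 1" "adj J y y'"
        using \<delta> by blast
      have yk: "a $ k < y $ k" using y by (auto simp: X_def Z)
      have "y' \<in> locations J" using adj_X[OF i(3)] .
      moreover have "a $ l \<le> y' $ l" if "l \<in> insert k J" for l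
        using nth[OF i(2), of l] y that yk J i by (auto simp: X_def split: if_splits)
      moreover have "y' $ l = a $ l" if "l \<notin> insert k J" for l
        using nth[OF i(2), of l] y that i by (auto simp: X_def split: if_splits)
      ultimately have "y' \<in> X" by (auto simp: X_def)
      moreover have "y' \<notin> U"
      proof
        assume "y' \<in> U"
        then obtain C where "C \<in> S" "placed_simplex y' (insert k J) face_of C" 
          by (auto simp: U locations_def)
        then show False
          using no_adj_above_simplex[of C y' k J y i] i J adj_commute by metis
      qed
      ultimately show "y' \<in> X - U" by blast
    qed
  qed (use fin in auto)
  moreover have sub: "Z \<subseteq> X" "U \<subseteq> X" by (auto simp: Z U)
  moreover have "card Z \<le> card X" "card U \<le> card X" using sub fin by (auto intro: card_mono)
  moreover have cards: "card (X - Z) = card X - card Z" "card (X - U) = card X - card U"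
    using sub fin by (auto simp: card_Diff_subset finite_subset)
  ultimately show le: "card (locations_above (insert k J) a) \<le> card (locations_above J a)"
    unfolding U_def[symmetric] Z_def[symmetric] by linarith
  \<comment> \<open>With \<open>a = 0\<close> the support condition for ascent holds, lower bounds
    survive the subtraction of \<open>axis i 1\<close>, and a positive coordinate at
    \<open>k\<close> means lying outside \<open>Z\<close>.\<close>
  assume a0: "a = 0"
  have "\<forall>y\<in>X - U. \<exists>y'. \<exists>i\<in>J. y' + axis i 1 = y + axis k 1 \<and> adj J y y'"
  proof
    fix y assume "y \<in> X - U"
    then have "y \<in> locations J" "\<And>l. l \<notin> insert k J \<Longrightarrow> y $ l = 0" "y \<notin> locations (insert k J)"
      using a0 by (auto simp: X_def U)
    then show "\<exists>y'. \<exists>i\<in>J. y' + axis i 1 = y + axis k 1 \<and> adj J y y'" 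
      using ex_adj_ascent[OF _ J] by blast
  qed
  then obtain \<pi> where \<pi>: "\<And>y. y \<in> X - U \<Longrightarrow> \<exists>i\<in>J. \<pi> y + axis i 1 = y + axis k 1 \<and> adj J y (\<pi> y)"
    by metis
  have "card (X - U) \<le> card (X - Z)"
  proof (rule card_inj_on_le[of \<pi>])
    show "inj_on \<pi> (X - U)"
    proof (rule inj_onI)
      fix y1 y2 assume y: "y1 \<in> X - U" "y2 \<in> X - U" "\<pi> y1 = \<pi> y2"
      obtain i1 where i1: "i1 \<in> J" "\<pi> y1 + axis i1 1 = y1 + axis k 1" "adj J y1 (\<pi> y1)"
        using \<pi>[OF y(1)] by blast
      obtain i2 where i2: "i2 \<in> J" "\<pi> y2 + axis i2 1 = y2 + axis k 1" "adj J y2 (\<pi> y2)"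
        using \<pi>[OF y(2)] by blast
      have "axis k 1 + (y1 + axis i2 1) = (y1 + axis k 1) + axis i2 (1::nat)" by (simp add: ac_simps)
      also have "\<dots> = (y2 + axis k 1) + axis i1 1"
        unfolding i1(2)[symmetric] i2(2)[symmetric] y(3) by (simp add: ac_simps)
      also have "\<dots> = axis k 1 + (y2 + axis i1 1)" by (simp add: ac_simps)
      finally have "y1 + axis i2 1 = y2 + axis i1 1" by simp
      then show "y1 = y2"
        by (intro adj_unique[of J "\<pi> y1" y1 y2 i1 i2]) (use i1 i2 y J adj_commute in auto)
    qed
    show "\<pi> ` (X - U) \<subseteq> X - Z"
    proof
      fix y' assume "y' \<in> \<pi> ` (X - U)"
      then obtain y where y: "y \<in> X - U" "y' = \<pi> y" by auto
      then obtain i where i: "i \<in> J" "y' + axis i 1 = y + axis k 1" "adj J y y'"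
        using \<pi> by blast
      have "y' \<in> locations J" using adj_X[OF i(3)] .
      moreover have "y' $ l = a $ l" if "l \<notin> insert k J" for l
        using nth[OF i(2)[symmetric], of l] y that i by (auto simp: X_def split: if_splits)
      moreover have "0 < y' $ k"
        using nth[OF i(2)[symmetric], of k] i J by (auto split: if_splits)
      ultimately show "y' \<in> X - Z" using a0 by (auto simp: X_def Z)
    qed
  qed (use fin in auto)
  then have "card Z \<le> card U"
    using cards sub fin card_mono[OF fin sub(1)] card_mono[OF fin sub(2)] by linarith
  with le show "card (locations_above (insert k J) a) = card (locations_above J a)"
    unfolding U_def[symmetric] Z_def[symmetric] by simp
qed

section \<open>The base case: lattice points on an edge\<close>

lemma card_locations_above_edge_le:
  assumes "p \<noteq> q"
  shows "card (locations_above {p, q} a) \<le> n - (\<Sum>i\<in>UNIV. a $ i)"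
proof -
  let ?X = "locations_above {p, q} a"
  have split: "(\<Sum>i\<in>UNIV. y $ i) = y $ p + y $ q + (\<Sum>i\<in>UNIV - {p, q}. y $ i)" for y :: "nat ^ 'd"
    using assms sum.subset_diff[of "{p, q}" UNIV "\<lambda>i. y $ i"] by simp
  have X: "y $ p + y $ q + (\<Sum>i\<in>UNIV - {p, q}. a $ i) + 1 = n" "a $ p \<le> y $ p" "a $ q \<le> y $ q"
    "\<And>l. l \<notin> {p, q} \<Longrightarrow> y $ l = a $ l"
    if "y \<in> ?X" for y
  proof -
    have "y \<in> T_points n" using that locations_T_points[of "{p, q}" y] by (simp add: locations_above_def)
    moreover have "(\<Sum>i\<in>UNIV - {p, q}. y $ i) = (\<Sum>i\<in>UNIV - {p, q}. a $ i)"
      using that by (intro sum.cong) (auto simp: locations_above_def)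
    ultimately show "y $ p + y $ q + (\<Sum>i\<in>UNIV - {p, q}. a $ i) + 1 = n"
      unfolding T_points_def using split[of y] by simp
  qed (use that in \<open>auto simp: locations_above_def\<close>)
  have "card ?X \<le> card {a $ p ..< a $ p + (n - (\<Sum>i\<in>UNIV. a $ i))}"
  proof (rule card_inj_on_le[of "\<lambda>y. y $ p"])
    show "inj_on (\<lambda>y. y $ p) ?X"
    proof (rule inj_onI)
      fix y z assume y: "y \<in> ?X" and z: "z \<in> ?X" and eq: "y $ p = z $ p"
      have "y $ q = z $ q" using X(1)[OF y] X(1)[OF z] eq by linarith
      with eq X(4)[OF y] X(4)[OF z] have "y $ l = z $ l" for l by (cases "l \<in> {p, q}") auto
      then show "y = z" by (simp add: vec_eq_iff)
    qed
    show "(\<lambda>y. y $ p) ` ?X \<subseteq> {a $ p ..< a $ p + (n - (\<Sum>i\<in>UNIV. a $ i))}"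
      using X(1-3) split[of a] by fastforce
  qed auto
  then show ?thesis by simp
qed

text \<open>In a tile through the midpoint of \<open>y + \<Delta>\<^sub>J\<close>,
  \<open>J = {p, q}\<close>, each summand contributes a point supported on \<open>{p, q}\<close>.
  The half-integral coordinate at \<open>p\<close> requires a summand containing both
  \<open>p\<close> and \<open>q\<close>; directness makes it unique, so all others contribute
  vertices.\<close>

lemma locations_edge:
  assumes "p \<noteq> q" "y \<in> T_points n" and supp: "\<And>l. l \<notin> {p, q} \<Longrightarrow> y $ l = 0"
  shows "y \<in> locations {p, q}"
proof -
  let ?x = "real_vec y + bary {p, q}"
  have xp: "?x $ p = real (y $ p) + 1/2" and xq: "?x $ q = real (y $ q) + 1/2"
    and xl: "\<And>l. l \<notin> {p, q} \<Longrightarrow> ?x $ l = 0"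
    using assms(1) supp by (auto simp: bary_nth)
  have "?x \<in> dilated_simplex n" using placed_bary_in_dilated[OF _ assms(2)] by simp
  then obtain C where C: "C \<in> S" "?x \<in> C" using Union_S by blast
  obtain A where A: "C = mixed_cell n A" "direct_cell n A" using C(1) by (rule tileE)
  obtain b where b: "\<And>j. j < n \<Longrightarrow> b j \<in> face_simplex (A j)" "?x = (\<Sum>j<n. b j)"
    using C(2) unfolding A(1) mixed_cell_iff by blast
  have b0: "b j $ l = 0" if "j < n" "l \<notin> {p, q}" for j l
  proof -
    have "(\<Sum>j<n. b j $ l) = 0" using xl[OF that(2)] unfolding b(2) by simp
    then have "\<forall>j\<in>{..<n}. b j $ l = 0"
      by (subst (asm) sum_nonneg_eq_0_iff) (use b(1) in \<open>auto simp: face_simplex_altdef\<close>)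
    with that show ?thesis by blast
  qed
  have vertex: "\<exists>s\<in>A j. b j = axis s 1" if j: "j < n" "\<not> {p, q} \<subseteq> A j" for j
  proof -
    obtain s where s: "s \<in> A j" "0 < b j $ s" using b(1)[OF j(1)] by (rule ex_pos_face_simplex)
    then have "s \<in> {p, q}" using b0[OF j(1), of s] by auto
    then have "l \<notin> {p, q} \<inter> A j" if "l \<noteq> s" for l using j(2) s(1) that by auto
    then have z: "b j $ l = 0" if "l \<noteq> s" for l
      using b0[OF j(1)] b(1)[OF j(1)] that by (auto simp: face_simplex_altdef)
    have "(\<Sum>l\<in>UNIV. b j $ l) = (\<Sum>l\<in>{s}. b j $ l)"
      using z by (intro sum.mono_neutral_right) auto
    then have "b j $ s = 1" using b(1)[OF j(1)] by (simp add: face_simplex_altdef)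
    with z have "b j = axis s 1" by (auto simp: vec_eq_iff axis_nth_if)
    with s show ?thesis by blast
  qed
  have ex_j0: "\<exists>j<n. {p, q} \<subseteq> A j"
  proof (rule ccontr)
    assume "\<not> ?thesis"
    then have "\<exists>s. b j = axis s 1" if "j < n" for j using vertex that by blast
    then have "b j $ p \<in> \<int>" if "j < n" for j
      using that by (metis Ints_0 Ints_1 axis_nth_if)
    then have "?x $ p \<in> \<int>" unfolding b(2) by (auto intro: Ints_sum)
    then have "(1/2 :: real) \<in> \<int>"
      unfolding xp by (metis Ints_diff Ints_of_nat add_diff_cancel_left')
    then show False by simp
  qed
  then obtain j0 where j0: "j0 < n" "{p, q} \<subseteq> A j0" by blast
  have "\<forall>j\<in>{..<n} - {j0}. \<exists>s. s \<in> A j \<and> b j = axis s 1"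
  proof
    fix j assume j: "j \<in> {..<n} - {j0}"
    then have "\<not> {p, q} \<subseteq> A j"
      using direct_cell_disjoint_pairs[OF A(2), of j j0 p q] j0 assms(1) by auto
    with vertex j show "\<exists>s. s \<in> A j \<and> b j = axis s 1" by blast
  qed
  then obtain f where f: "\<And>j. j \<in> {..<n} - {j0} \<Longrightarrow> f j \<in> A j \<and> b j = axis (f j) 1"
    by metis
  define z where "z = (\<Sum>j\<in>{..<n} - {j0}. axis (f j) (1::nat))"
  have "(\<Sum>j\<in>{..<n} - {j0}. b j) = real_vec z"
    using f by (simp add: z_def real_vec_sum)
  then have x: "?x = b j0 + real_vec z" unfolding b(2) using j0(1) by (simp add: sum.remove)
  have b01: "0 \<le> b j0 $ l" "b j0 $ l \<le> 1" for l
  proof -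
    have bj: "b j0 \<in> face_simplex (A j0)" using b j0 by auto
    then have "b j0 $ l \<le> (\<Sum>l\<in>UNIV. b j0 $ l)"
      by (intro member_le_sum) (auto simp: face_simplex_altdef)
    then show "0 \<le> b j0 $ l" "b j0 $ l \<le> 1" using bj by (auto simp: face_simplex_altdef)
  qed
  have "y $ l = z $ l" for l
  proof (cases "l \<in> {p, q}")
    case True
    have "?x $ l = b j0 $ l + real (z $ l)" by (simp add: x)
    moreover have "?x $ l = real (y $ l) + 1/2" using True xp xq by blast
    ultimately have "real (y $ l) + 1/2 = b j0 $ l + real (z $ l)" by linarith
    \<comment> \<open>The offset \<open>1/2\<close> leaves a difference of at most
      \<open>1/2\<close>, so the two integers coincide.\<close>
    then have "\<bar>real (y $ l) - real (z $ l)\<bar> < 1" using b01[of l] by linarith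
    then show ?thesis by linarith
  next
    case False
    have "?x $ l = b j0 $ l + real (z $ l)" by (simp add: x)
    then show ?thesis using xl[OF False] supp[OF False] b01[of l] by simp
  qed
  then have "cell_face n A {p, q} y j0 f"
    using j0 f by (auto simp: cell_face_def z_def vec_eq_iff)
  then show ?thesis
    unfolding locations_def using cell_face_imp_face_of[OF A(2)] A(1) C(1) by blast
qed

lemma card_locations_above_edge_0:
  assumes "p \<noteq> q"
  shows "card (locations_above {p, q} 0) = n"
proof (rule antisym)
  show "card (locations_above {p, q} 0) \<le> n"
    using card_locations_above_edge_le[OF assms, of 0] by simp
  \<comment> \<open>All lattice points of coordinate sum \<open>n - 1\<close> on the edge; the bound
    \<open>m < n\<close> makes the truncated difference exact.\<close>
  define g :: "nat \<Rightarrow> nat ^ 'd" where "g m = (\<chi> i. if i = p then m else if i = q then n - 1 - m else 0)" for m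
  have "card {..<n} \<le> card (locations_above {p, q} 0)"
  proof (rule card_inj_on_le[of g])
    show "inj_on g {..<n}"
    proof (rule inj_onI)
      fix m m' assume "g m = g m'"
      then have "g m $ p = g m' $ p" by simp
      then show "m = m'" by (simp add: g_def)
    qed
    show "g ` {..<n} \<subseteq> locations_above {p, q} 0"
    proof clarify
      fix m assume m: "m < n"
      have "(\<Sum>i\<in>UNIV. g m $ i) = (\<Sum>i\<in>{p, q}. g m $ i)"
        by (intro sum.mono_neutral_right) (auto simp: g_def)
      also have "\<dots> = n - 1" using assms m by (auto simp: g_def)
      finally have "g m \<in> T_points n" using n_pos by (simp add: T_points_def)
      then have "g m \<in> locations {p, q}"
        by (rule locations_edge[OF assms]) (auto simp: g_def)
      then show "g m \<in> locations_above {p, q} 0"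
        using assms by (auto simp: locations_above_def g_def)
    qed
    show "finite (locations_above {p, q} 0)"
      by (rule finite_subset[OF _ finite_T_points[of n]]) 
        (use locations_T_points[of "{p, q}"] in \<open>auto simp: locations_above_def\<close>)
  qed
  then show "n \<le> card (locations_above {p, q} 0)" by simp
qed

lemma card_locations_above:
  assumes "2 \<le> card J"
  shows "card (locations_above J a) \<le> n - (\<Sum>i\<in>UNIV. a $ i)"
    and "card (locations_above J 0) = n"
proof -
  obtain p q where pq: "p \<in> J" "q \<in> J" "p \<noteq> q"
    using assms card_le_Suc0_iff_eq[of J] by fastforce
  \<comment> \<open>Taking the union with \<open>{p, q}\<close> makes the edge the base case of an
    induction over arbitrary finite \<open>K\<close>.\<close>
  have "card (locations_above (K \<union> {p, q}) a) \<le> n - (\<Sum>i\<in>UNIV. a $ i) \<and>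
      card (locations_above (K \<union> {p, q}) 0) = n" for K
  proof (induction K rule: finite_induct[OF finite])
    case 1
    then show ?case
      using card_locations_above_edge_le[OF pq(3)] card_locations_above_edge_0[OF pq(3)] by simp
  next
    case (2 k K)
    show ?case
    proof (cases "k \<in> K \<union> {p, q}")
      case True
      then have "insert k K \<union> {p, q} = K \<union> {p, q}" by auto
      then show ?thesis using 2 by presburger
    next
      case False
      have "card {p, q} \<le> card (K \<union> {p, q})" by (intro card_mono) auto
      then have "2 \<le> card (K \<union> {p, q})" using pq by simp
      from card_locations_above_insert[OF this False] show ?thesis
        using 2 by (metis (no_types) Un_insert_left le_trans)
    qed
  qed
  from this[of J] pq show "card (locations_above J a) \<le> n - (\<Sum>i\<in>UNIV. a $ i)"
    and "card (locations_above J 0) = n"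
    by (simp_all add: insert_absorb)
qed

subsection \<open>Simplex tiles\<close>

lemma simplex_locations_altdef:
  "simplex_locations n S = {y \<in> T_points n. placed_simplex y UNIV \<in> S}"
  using simplex_placed_UNIV
  unfolding simplex_locations_def simplex_tiles_def placed_simplex_def face_simplex_UNIV real_vec_def 
  by auto

text \<open>By \<open>cell_face_UNIV\<close>, a tile with a face
  \<open>placed_simplex y UNIV\<close> equals that face.\<close>

lemma locations_UNIV: 
  assumes "CARD('d) \<ge> 2"
  shows "locations UNIV = simplex_locations n S"
proof (intro set_eqI iffI)
  fix y assume "y \<in> simplex_locations n S"
  then have "placed_simplex y UNIV \<in> S" by (simp add: simplex_locations_altdef)
  then show "y \<in> locations UNIV"
    unfolding locations_def using tile_convex face_of_refl by blast
next
  fix y assume y: "y \<in> locations UNIV"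
  then obtain C where C: "C \<in> S" "placed_simplex y UNIV face_of C" by (auto simp: locations_def)
  obtain A where A: "C = mixed_cell n A" "direct_cell n A" using C(1) by (rule tileE)
  obtain j0 f where "cell_face n A UNIV y j0 f"
    using face_of_imp_cell_face[of y UNIV n A] A(1) C(2) assms by auto
  then have "C = placed_simplex y UNIV" using cell_face_UNIV[OF A(2)] A(1) by simp
  then show "y \<in> simplex_locations n S"
    using locations_T_points[OF _ y] C(1) by (simp add: simplex_locations_altdef)
qed

lemma card_simplex_locations:
  assumes "CARD('d) \<ge> 2"
  shows "card (simplex_locations n S) = n"
proof -
  have "locations_above UNIV 0 = locations UNIV" by (auto simp: locations_above_def)
  then show ?thesis
    using card_locations_above(2)[of UNIV] locations_UNIV[OF assms] assms by simp
qed

text \<open>Two summands with at least two vertices each would produce a parallelogram of extreme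
  points, which \<open>simplex_diagonals\<close> excludes. The one remaining nontrivial summand
  carries the whole dimension, so it is the full simplex.\<close>

lemma simplex_tile_placed:
  assumes d: "CARD('d) \<ge> 2" and C: "C \<in> S" "k simplex C"
  shows "C \<in> (\<lambda>y. placed_simplex y UNIV) ` simplex_locations n S"
proof -
  obtain A where A: "C = mixed_cell n A" "direct_cell n A" "\<And>j. j < n \<Longrightarrow> A j \<noteq> {}"
    and dim: "(\<Sum>j<n. aff_dim (face_simplex (A j))) = int CARD('d) - 1" 
    by (rule tileE[OF C(1)]) blast
  have "\<forall>j. \<exists>s. j < n \<longrightarrow> s \<in> A j" using A(3) by blast
  then obtain g where g: "\<And>j. j < n \<Longrightarrow> g j \<in> A j" by metis
  have one: "i = j" if ij: "i < n" "j < n" and ab: "a \<in> A i" "b \<in> A i" "a \<noteq> b" 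
    and cd: "c \<in> A j" "c' \<in> A j" "c \<noteq> c'" for i j a b c c'
  proof (rule ccontr)
    assume ne: "i \<noteq> j"
    \<comment> \<open>\<open>V s t\<close> is the vertex of the tile with \<open>s\<close> and
      \<open>t\<close> chosen in the summands \<open>i\<close> and \<open>j\<close>; the other
      choices contribute the constant \<open>W\<close>.\<close>
    define h where "h s t = g(i := s, j := t)" for s t
    define V where "V s t = (\<Sum>l<n. axis (h s t l) (1::real))" for s t
    define W where "W = (\<Sum>l\<in>{..<n} - {i} - {j}. axis (g l) (1::real))"
    have V: "V s t = axis s 1 + (axis t 1 + W)" for s t
      using ij ne by (simp add: V_def W_def h_def sum.remove[of "{..<n}" i] sum.remove[of "{..<n} - {i}" j])
    have ext: "{V s t} face_of C" if "s \<in> A i" "t \<in> A j" for s t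
      unfolding V_def A(1) by (rule mixed_cell_vertex_face_of[OF A(2)]) (use that g ne in \<open>auto simp: h_def\<close>)
    have "V a c + V b c' = V a c' + V b c" by (simp add: V algebra_simps)
    then have "V a c' = V a c \<or> V a c' = V b c'"
      using simplex_diagonals[OF C(2)] ext ab cd by blast
    then show False using ab cd by (auto simp: V)
  qed
  have "\<exists>j0<n. A j0 = UNIV"
  proof -
    have "\<exists>j0<n. \<forall>j<n. j \<noteq> j0 \<longrightarrow> is_singleton (A j)"
    proof (rule ccontr)
      assume no: "\<not> ?thesis"
      then obtain i where i: "i < n" "\<not> is_singleton (A i)"
        using n_pos by (metis One_nat_def Suc_le_lessD)
      with no obtain j where j: "j < n" "j \<noteq> i" "\<not> is_singleton (A j)" by metis
      obtain a b where "a \<in> A i" "b \<in> A i" "a \<noteq> b"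
        using i A(3) by (metis is_singletonI' )
      moreover obtain c c' where "c \<in> A j" "c' \<in> A j" "c \<noteq> c'"
        using j A(3) by (metis is_singletonI' )
      ultimately show False using one i j by blast
    qed
    then obtain j0 where j0: "j0 < n" and sing: "\<And>j. j < n \<Longrightarrow> j \<noteq> j0 \<Longrightarrow> is_singleton (A j)" by blast
    have "(\<Sum>j<n. aff_dim (face_simplex (A j))) = (\<Sum>j\<in>{j0}. aff_dim (face_simplex (A j)))"
    proof (rule sum.mono_neutral_right)
      show "\<forall>j\<in>{..<n} - {j0}. aff_dim (face_simplex (A j)) = 0"
      proof
        fix j assume "j \<in> {..<n} - {j0}"
        then obtain x where "A j = {x}" using sing[of j] by (auto elim: is_singletonE)
        then show "aff_dim (face_simplex (A j)) = 0" by simp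
      qed
    qed (use j0 in auto)
    then have "CARD('d) \<le> card (A j0)"
      using dim aff_dim_face_simplex_le[of "A j0"] by simp
    then have "A j0 = UNIV" by (metis card_seteq finite subset_UNIV)
    with j0 show ?thesis by blast
  qed
  then obtain j0 where j0: "j0 < n" "A j0 = UNIV" by blast
  define y where "y = (\<Sum>j\<in>{..<n} - {j0}. axis (g j) (1::nat))"
  have "cell_face n A UNIV y j0 g"
    using g j0 by (auto simp: cell_face_def y_def)
  then have Cy: "C = placed_simplex y UNIV" using cell_face_UNIV[OF A(2)] A(1) by simp
  then have "y \<in> locations UNIV"
    unfolding locations_def using C(1) tile_convex face_of_refl by blast
  then show ?thesis using Cy locations_UNIV[OF d] by blast
qed

lemma card_simplex_tiles:
  assumes d: "CARD('d) \<ge> 2"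
  shows "card (simplex_tiles S) = n"
proof -
  have "simplex_tiles S = (\<lambda>y. placed_simplex y UNIV) ` simplex_locations n S"
  proof
    show "simplex_tiles S \<subseteq> (\<lambda>y. placed_simplex y UNIV) ` simplex_locations n S"
      using simplex_tile_placed[OF d] by (auto simp: simplex_tiles_def)
    show "(\<lambda>y. placed_simplex y UNIV) ` simplex_locations n S \<subseteq> simplex_tiles S"
      using simplex_placed_UNIV by (auto simp: simplex_locations_altdef simplex_tiles_def)
  qed
  moreover have "inj_on (\<lambda>y. placed_simplex y UNIV) (simplex_locations n S)"
    using placed_simplex_inj[OF d] by (auto intro: inj_onI)
  ultimately show ?thesis using card_image card_simplex_locations[OF d] by metis
qed

section \<open>The case of a single summand\<close>

lemma dilated_simplex_nonempty: "(dilated_simplex n :: (real ^ 'd) set) \<noteq> {}"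
proof -
  have "real n *\<^sub>R axis (undefined :: 'd) 1 \<in> dilated_simplex n"
    by (rule in_dilated_simplex[OF _ _ n_pos]) (auto simp: axis_nth_if simp flip: sum_distrib_left)
  then show ?thesis by blast
qed

lemma card_simplex_tiles_1:
  assumes "n = 1"
  shows "card (simplex_tiles S) = n"
proof -
  have tile: "C = placed_simplex 0 UNIV" if C: "C \<in> S" for C
  proof -
    obtain A where A: "C = mixed_cell n A"
      and dim: "(\<Sum>j<n. aff_dim (face_simplex (A j))) = int CARD('d) - 1" 
      by (rule tileE[OF C]) blast
    have "CARD('d) \<le> card (A 0)"
      using dim aff_dim_face_simplex_le[of "A 0"] assms by simp
    then have "A 0 = UNIV" by (metis card_seteq finite subset_UNIV)
    then show ?thesis using A assms by (simp add: mixed_cell_def placed_simplex_def)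
  qed
  moreover have "S \<noteq> {}" using Union_S dilated_simplex_nonempty by auto
  ultimately have "S = {placed_simplex 0 UNIV}" by blast
  then have "simplex_tiles S = {placed_simplex 0 UNIV}"
    using simplex_placed_UNIV by (auto simp: simplex_tiles_def)
  then show ?thesis using assms by simp
qed

section \<open>The basis property\<close>

lemma simplex_locations_subset: "simplex_locations n S \<subseteq> T_points n"
  by (auto simp: simplex_locations_def)

lemma basis_simplex_locations:
  assumes d: "CARD('d) \<ge> 2"
  shows "matroid_basis (T_indep n) (simplex_locations n S)"
  unfolding matroid_basis_def
proof (intro conjI allI impI)
  show "T_indep n (simplex_locations n S)"
    unfolding T_indep_def
  proof (intro conjI ballI allI impI simplex_locations_subset)
    fix k and a :: "nat ^ 'd" assume k: "(\<Sum>i\<in>UNIV. a $ i) + k = n"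
    have "{x \<in> T_points n. \<forall>i. a $ i \<le> x $ i} \<inter> simplex_locations n S = locations_above UNIV a"
      using simplex_locations_subset by (auto simp: locations_above_def locations_UNIV[OF d])
    then show "card ({x \<in> T_points n. \<forall>i. a $ i \<le> x $ i} \<inter> simplex_locations n S) \<le> k"
      using card_locations_above(1)[of UNIV a] d k by simp
  qed
  fix I :: "(nat ^ 'd) set" assume I: "T_indep n I \<and> simplex_locations n S \<subseteq> I"
  then have "I \<subseteq> T_points n" by (simp add: T_indep_def)
  \<comment> \<open>Maximality: the condition for \<open>k = n\<close> and \<open>a = 0\<close>
    bounds every independent set by \<open>n\<close>, a size already attained.\<close>
  moreover have "card ({x \<in> T_points n. \<forall>i. (0 :: nat ^ 'd) $ i \<le> x $ i} \<inter> I) \<le> n"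
  proof -
    have "n \<in> {1..n}" using n_pos by simp
    moreover have "(\<Sum>i\<in>UNIV. (0 :: nat ^ 'd) $ i) + n = n" by simp
    ultimately show ?thesis using I unfolding T_indep_def by blast
  qed
  moreover have "{x \<in> T_points n. \<forall>i. (0 :: nat ^ 'd) $ i \<le> x $ i} \<inter> I = I"
    using \<open>I \<subseteq> T_points n\<close> by auto
  ultimately have "card I \<le> card (simplex_locations n S)" 
    using card_simplex_locations[OF d] by simp
  then show "I = simplex_locations n S"
    using I \<open>I \<subseteq> T_points n\<close> finite_T_points card_seteq finite_subset by metis
qed

text \<open>Here \<open>T_points n\<close> has one point, with coordinate \<open>n - 1\<close>, and
  a nonempty tile can only be the point \<open>real n *\<^sub>R axis u 1\<close>, located
  there.\<close>

lemma basis_simplex_locations_dim_1: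
  assumes "CARD('d) = 1"
  shows "matroid_basis (T_indep n) (simplex_locations n S)"
proof -
  obtain u :: 'd where u: "UNIV = {u}" using assms by (metis card_1_singletonE)
  define y :: "nat ^ 'd" where "y = (\<chi> i. n - 1)"
  note sum = sum_vec_UNIV_singleton[OF u] and eqI = vec_eqI_UNIV_singleton[OF u]
  have T: "T_points n = {y}"
    using n_pos eqI[of _ y] by (auto simp: T_points_def sum y_def)
  obtain C where C: "C \<in> S" "C \<noteq> {}"
    using dilated_simplex_nonempty unfolding Union_S[symmetric] by blast
  have "x = real n *\<^sub>R axis u 1" if "x \<in> C" for x
    by (rule eqI) (use tile_coords[OF C(1) that] in \<open>simp add: sum\<close>)
  then have "C = {real n *\<^sub>R axis u 1}" using C(2) by blast
  moreover have "real_vec y + axis u 1 = real n *\<^sub>R axis u 1"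
    by (rule eqI) (use n_pos in \<open>simp add: y_def\<close>)
  ultimately have "placed_simplex y UNIV = C"
    by (simp add: placed_simplex_def u)
  then have L: "simplex_locations n S = {y}" using C T by (auto simp: simplex_locations_altdef)
  have "card (X \<inter> {y}) \<le> k" if "k \<in> {1..n}" for X k
    using card_mono[of "{y}" "X \<inter> {y}"] that by simp
  then have "T_indep n {y}" unfolding T_indep_def T by blast
  moreover have "I = {y}" if "T_indep n I" "{y} \<subseteq> I" for I
    using that T by (auto simp: T_indep_def)
  ultimately show ?thesis unfolding L matroid_basis_def by blast
qed

end

text \<open>The count carries a condition because for \<open>d = 1\<close> the dilated simplex is a
  point: the only tile is a single 0-simplex, whatever \<open>n\<close> is.\<close>

theorem proposition8p2:
  fixes n :: nat and S :: "(real ^ 'd) set set"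
  assumes "n \<ge> 1"
    and "fine_mixed_subdivision n S"
  shows "(CARD('d) \<ge> 2 \<or> n = 1 \<longrightarrow> card (simplex_tiles S) = n) \<and>
         matroid_basis (T_indep n) (simplex_locations n S)"
proof -
  interpret mixed_subdivision n S using assms by unfold_locales
  have "CARD('d) \<ge> 2 \<or> CARD('d) = 1" using zero_less_card_finite[where 'a = 'd] by linarith
  then show ?thesis
    using card_simplex_tiles card_simplex_tiles_1 basis_simplex_locations basis_simplex_locations_dim_1
    by blast
qed

end
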